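(* There is an algorithm which, given any instance of fair division with $n=2$ agents having (possibly different) additive valuations $v_1,v_2:2^M\to\mathbb R_{\ge0}$, $m$ goods $M$, and conflict graph $G=(M,E)$, computes a complete EF1 allocation $(A_1,A_2)$ with at most $|E|/2$ violations in $O(m\log m+|E|)$ time.
   Context: $M=\{1,\dots,m\}$ is a set of indivisible goods. A valuation $v_i$ is additive if $v_i(S)=\sum_{g\in S}v_i(\{g\})$ for all $S\subseteq M$. An allocation to two agents is a pair $(A_1,A_2)$ of disjoint subsets of $M$; it is complete if $A_1\cup A_2=M$. It is EF1 (envy-free up to one good) if for $(i,j)\in\{(1,2),(2,1)\}$, either $A_j=\emptyset$ or there is $g\in A_j$ with $v_i(A_i)\ge v_i(A_j\setminus\{g\})$. The conflict graph $G=(M,E)$ is a simple undirected graph on the goods; an edge $\{u,w\}\in E$ is violated if $\{u,w\}\subseteq A_i$ for some $i$, and the number of violations is the number of violated edges. Running time counts elementary operations, with arithmetic and comparison of valuations at unit cost. *)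

theory Defs
  imports Complex_Main
begin

definition additive_valuation :: "nat set \<Rightarrow> (nat set \<Rightarrow> real) \<Rightarrow> bool" where
  "additive_valuation M v \<longleftrightarrow>
     (\<forall>S. S \<subseteq> M \<longrightarrow> 0 \<le> v S \<and> v S = (\<Sum>g\<in>S. v {g}))"

definition simple_graph :: "nat set \<Rightarrow> nat set set \<Rightarrow> bool" where
  "simple_graph M E \<longleftrightarrow> (\<forall>e\<in>E. e \<subseteq> M \<and> card e = 2)"

text \<open>Valuations and allocations are indexed by the agents 1 and 2; their values at other
  indices are irrelevant.\<close>

definition fair_division_instance :: "nat \<Rightarrow> nat set set \<Rightarrow> (nat \<Rightarrow> nat set \<Rightarrow> real) \<Rightarrow> bool" where
  "fair_division_instance m E v \<longleftrightarrow>
     simple_graph {1..m} E \<and> (\<forall>i\<in>{1, 2}. additive_valuation {1..m} (v i))"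

definition complete_allocation :: "nat set \<Rightarrow> (nat \<Rightarrow> nat set) \<Rightarrow> bool" where
  "complete_allocation M A \<longleftrightarrow> A 1 \<inter> A 2 = {} \<and> A 1 \<union> A 2 = M"

definition EF1 :: "(nat \<Rightarrow> nat set \<Rightarrow> real) \<Rightarrow> (nat \<Rightarrow> nat set) \<Rightarrow> bool" where
  "EF1 v A \<longleftrightarrow>
     (\<forall>(i, j)\<in>{(1, 2), (2, 1)}. A j = {} \<or> (\<exists>g\<in>A j. v i (A i) \<ge> v i (A j - {g})))"

definition violations :: "nat set set \<Rightarrow> (nat \<Rightarrow> nat set) \<Rightarrow> nat" where
  "violations E A = card {e \<in> E. \<exists>i\<in>{1, 2}. e \<subseteq> A i}"

text \<open>The memory consists of named, unbounded arrays of natural numbers and of real numbers;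
  a scalar variable is cell 0 of an array. Natural numbers serve as indices and counters and
  can only be added, subtracted (truncated at 0) and compared, so that no exponentially large
  number can be built in a logarithmic number of steps by repeated squaring. Reals support
  field arithmetic and comparison. There are no conversions between the two sorts, and the
  only real literals are integers, so that a program cannot carry hidden information in a
  real constant.\<close>

datatype nexp =
    NConst nat
  | NLoad string nexp
  | NAdd nexp nexp
  | NSub nexp nexp

datatype rexp =
    RConst int
  | RLoad string nexp
  | RAdd rexp rexp
  | RSub rexp rexp
  | RMul rexp rexp
  | RDiv rexp rexp

datatype bexp =
    NLe nexp nexp
  | RLe rexp rexp
  | Neg bexp
  | Conj bexp bexp

datatype com =
    Skip
  | NStore string nexp nexp
  | RStore string nexp rexp
  | Seq com com
  | Cond bexp com com
  | While bexp com

record state =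
  nmem :: "string \<Rightarrow> nat \<Rightarrow> nat"
  rmem :: "string \<Rightarrow> nat \<Rightarrow> real"

primrec nval :: "nexp \<Rightarrow> state \<Rightarrow> nat" where
  "nval (NConst k) s = k"
| "nval (NLoad x a) s = nmem s x (nval a s)"
| "nval (NAdd a b) s = nval a s + nval b s"
| "nval (NSub a b) s = nval a s - nval b s"

primrec rval :: "rexp \<Rightarrow> state \<Rightarrow> real" where
  "rval (RConst k) s = of_int k"
| "rval (RLoad x a) s = rmem s x (nval a s)"
| "rval (RAdd a b) s = rval a s + rval b s"
| "rval (RSub a b) s = rval a s - rval b s"
| "rval (RMul a b) s = rval a s * rval b s"
| "rval (RDiv a b) s = rval a s / rval b s"

primrec bval :: "bexp \<Rightarrow> state \<Rightarrow> bool" where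
  "bval (NLe a b) s \<longleftrightarrow> nval a s \<le> nval b s"
| "bval (RLe a b) s \<longleftrightarrow> rval a s \<le> rval b s"
| "bval (Neg b) s \<longleftrightarrow> \<not> bval b s"
| "bval (Conj b c) s \<longleftrightarrow> bval b s \<and> bval c s"

text \<open>Every literal, memory access, arithmetic or Boolean operation, comparison, store and
  branch costs one unit.\<close>

primrec ncost :: "nexp \<Rightarrow> nat" where
  "ncost (NConst k) = 1"
| "ncost (NLoad x a) = 1 + ncost a"
| "ncost (NAdd a b) = 1 + ncost a + ncost b"
| "ncost (NSub a b) = 1 + ncost a + ncost b"

primrec rcost :: "rexp \<Rightarrow> nat" where
  "rcost (RConst k) = 1"
| "rcost (RLoad x a) = 1 + ncost a"
| "rcost (RAdd a b) = 1 + rcost a + rcost b"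
| "rcost (RSub a b) = 1 + rcost a + rcost b"
| "rcost (RMul a b) = 1 + rcost a + rcost b"
| "rcost (RDiv a b) = 1 + rcost a + rcost b"

primrec bcost :: "bexp \<Rightarrow> nat" where
  "bcost (NLe a b) = 1 + ncost a + ncost b"
| "bcost (RLe a b) = 1 + rcost a + rcost b"
| "bcost (Neg b) = 1 + bcost b"
| "bcost (Conj b c) = 1 + bcost b + bcost c"

definition nstore :: "string \<Rightarrow> nat \<Rightarrow> nat \<Rightarrow> state \<Rightarrow> state" where
  "nstore x k a s = s\<lparr>nmem := (nmem s)(x := (nmem s x)(k := a))\<rparr>"

definition rstore :: "string \<Rightarrow> nat \<Rightarrow> real \<Rightarrow> state \<Rightarrow> state" where
  "rstore x k a s = s\<lparr>rmem := (rmem s)(x := (rmem s x)(k := a))\<rparr>"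

text \<open>\<open>exec P s t s'\<close>: started in \<open>s\<close>, the program \<open>P\<close> halts in \<open>s'\<close> after \<open>t\<close> elementary
  operations.\<close>

inductive exec :: "com \<Rightarrow> state \<Rightarrow> nat \<Rightarrow> state \<Rightarrow> bool" where
  Skip: "exec Skip s 1 s"
| NStore: "exec (NStore x i a) s (1 + ncost i + ncost a) (nstore x (nval i s) (nval a s) s)"
| RStore: "exec (RStore x i a) s (1 + ncost i + rcost a) (rstore x (nval i s) (rval a s) s)"
| Seq: "exec c s t s' \<Longrightarrow> exec d s' t' s'' \<Longrightarrow> exec (Seq c d) s (t + t') s''"
| CondTrue: "bval b s \<Longrightarrow> exec c s t s' \<Longrightarrow> exec (Cond b c d) s (1 + bcost b + t) s'"
| CondFalse: "\<not> bval b s \<Longrightarrow> exec d s t s' \<Longrightarrow> exec (Cond b c d) s (1 + bcost b + t) s'"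
| WhileFalse: "\<not> bval b s \<Longrightarrow> exec (While b c) s (1 + bcost b) s"
| WhileTrue: "bval b s \<Longrightarrow> exec c s t s' \<Longrightarrow> exec (While b c) s' t' s'' \<Longrightarrow>
    exec (While b c) s (1 + bcost b + t + t') s''"

inductive_cases SkipE: "exec Skip s t s'"
  and NStoreE: "exec (NStore x i a) s t s'"
  and RStoreE: "exec (RStore x i a) s t s'"
  and SeqE: "exec (Seq c d) s t s'"
  and CondE: "exec (Cond b c d) s t s'"
  and WhileE: "exec (While b c) s t s'"

lemma exec_deterministic:
  "exec P s t s' \<Longrightarrow> exec P s u r \<Longrightarrow> u = t \<and> r = s'"
proof (induction arbitrary: u r rule: exec.induct)
  case (Skip s)
  then show ?case by (rule SkipE) simp
next
  case (NStore x i a s)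
  then show ?case by (rule NStoreE) simp
next
  case (RStore x i a s)
  then show ?case by (rule RStoreE) simp
next
  case (Seq c s t s' d t' s'')
  from Seq.prems show ?case
    by (rule SeqE) (metis Seq.IH)
next
  case (CondTrue b s c t s' d)
  from CondTrue.prems show ?case
    by (rule CondE) (auto simp: CondTrue.hyps(1) dest: CondTrue.IH)
next
  case (CondFalse b s d t s' c)
  from CondFalse.prems show ?case
    by (rule CondE) (auto simp: CondFalse.hyps(1) dest: CondFalse.IH)
next
  case (WhileFalse b s c)
  from WhileFalse.prems show ?case
    by (rule WhileE) (simp_all add: WhileFalse.hyps)
next
  case (WhileTrue b s c t s' t' s'')
  from WhileTrue.prems show ?case
    by (rule WhileE) (auto simp: WhileTrue.hyps(1) dest!: WhileTrue.IH)
qed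

text \<open>The graph is given as a list of its edges: every edge occurs exactly once, in one of its
  two orientations. The order of the list and the orientations are arbitrary.\<close>

definition edge_listing :: "nat set set \<Rightarrow> (nat \<times> nat) list \<Rightarrow> bool" where
  "edge_listing E es \<longleftrightarrow>
     distinct (map (\<lambda>(u, w). {u, w}) es) \<and> set (map (\<lambda>(u, w). {u, w}) es) = E"

text \<open>An additive valuation is given by its values on the single goods. All memory not used by
  the input is initially 0.\<close>

definition input_state :: "nat \<Rightarrow> (nat \<times> nat) list \<Rightarrow> (nat \<Rightarrow> nat set \<Rightarrow> real) \<Rightarrow> state" where
  "input_state m es v =
     \<lparr>nmem = (\<lambda>_ _. 0)
        (''goods'' := (\<lambda>_. 0)(0 := m),
         ''edges'' := (\<lambda>_. 0)(0 := length es),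
         ''tail'' := (\<lambda>k. if k < length es then fst (es ! k) else 0),
         ''head'' := (\<lambda>k. if k < length es then snd (es ! k) else 0)),
      rmem = (\<lambda>_ _. 0)
        (''value1'' := (\<lambda>g. if g \<in> {1..m} then v 1 {g} else 0),
         ''value2'' := (\<lambda>g. if g \<in> {1..m} then v 2 {g} else 0))\<rparr>"

definition output_allocation :: "nat \<Rightarrow> state \<Rightarrow> nat \<Rightarrow> nat set" where
  "output_allocation m s i = {g \<in> {1..m}. nmem s ''owner'' g = i}"

end

theory Submission
  imports Defs "HOL-Library.Multiset"
begin

text \<open>Violations depend only on the unordered partition, so it suffices to find a partition whose
  two parts are both acceptable up to one good for agent 1 and which violates at most half of
  the edges; agent 2 then takes the part she prefers and does not envy at all.

  Sort the goods by decreasing value for agent 1 and pair them consecutively. If each part gets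
  one good of every pair, then the good that one part gets from pair \<open>q + 1\<close> is worth at most the
  good that the other part gets from pair \<open>q\<close>, so envy disappears once the good from pair 0 is
  removed. The pairs are oriented greedily: an edge is charged to the later of the pairs of its
  endpoints, and the two orientations of a pair violate complementary sets of the edges charged
  to it that leave the pair, so one of them violates at most half. Each edge is inspected once.

  Padding with worthless goods outside \<open>{1..m}\<close>, whose memory cells are 0, makes the number of
  goods a power of 2, which spares mergesort the incomplete blocks and makes the pairing perfect.\<close>

subsection \<open>Reasoning about programs and their running time\<close>

text \<open>Total correctness with a time bound. The existential form loses nothing because
  \<open>exec\<close> is deterministic.\<close>

definition runs :: "com \<Rightarrow> state \<Rightarrow> nat \<Rightarrow> (state \<Rightarrow> bool) \<Rightarrow> bool" where
  "runs c s T Q \<longleftrightarrow> (\<exists>t s'. exec c s t s' \<and> t \<le> T \<and> Q s')"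

text \<open>Syntactic over-approximation of the arrays a program can change, for both memories at
  once. Together with \<open>agree\<close> it serves as a frame rule, so that loop invariants need
  to mention only what changes.\<close>

primrec writes :: "com \<Rightarrow> string set" where
  "writes Skip = {}"
| "writes (NStore x i a) = {x}"
| "writes (RStore x i a) = {x}"
| "writes (Seq c d) = writes c \<union> writes d"
| "writes (Cond b c d) = writes c \<union> writes d"
| "writes (While b c) = writes c"

definition agree :: "string set \<Rightarrow> state \<Rightarrow> state \<Rightarrow> bool" where
  "agree W s s' \<longleftrightarrow> (\<forall>x. x \<notin> W \<longrightarrow> nmem s' x = nmem s x \<and> rmem s' x = rmem s x)"

lemma agree_refl: "agree W s s"
  by (simp add: agree_def)

lemma agree_trans: "agree W s s' \<Longrightarrow> agree W s' s'' \<Longrightarrow> agree W s s''"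
  by (simp add: agree_def)

lemma nmem_nstore [simp]: "nmem (nstore x k a s) = (nmem s)(x := (nmem s x)(k := a))"
  and rmem_nstore [simp]: "rmem (nstore x k a s) = rmem s"
  and nmem_rstore [simp]: "nmem (rstore x k c s) = nmem s"
  and rmem_rstore [simp]: "rmem (rstore x k c s) = (rmem s)(x := (rmem s x)(k := c))"
  by (simp_all add: nstore_def rstore_def)

lemma exec_agree: "exec c s t s' \<Longrightarrow> agree (writes c) s s'"
  by (induction rule: exec.induct) (auto simp: agree_def)

lemma runsE:
  assumes "runs c s T Q"
  obtains t s' where "exec c s t s'" "t \<le> T" "Q s'" "agree (writes c) s s'"
  using assms exec_agree by (auto simp: runs_def)

lemma runs_mono: "runs c s T Q \<Longrightarrow> T \<le> U \<Longrightarrow> (\<And>s'. Q s' \<Longrightarrow> R s') \<Longrightarrow> runs c s U R"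
  unfolding runs_def using le_trans by blast

lemma runs_Seq:
  assumes "runs c s T Q"
    and "\<And>s'. Q s' \<Longrightarrow> agree (writes c) s s' \<Longrightarrow> runs d s' U R"
    and "T + U \<le> B"
  shows "runs (Seq c d) s B R"
proof -
  obtain t s' where c: "exec c s t s'" "t \<le> T" "Q s'"
    using assms(1) by (auto simp: runs_def)
  obtain u s'' where d: "exec d s' u s''" "u \<le> U" "R s''"
    using assms(2)[OF c(3) exec_agree[OF c(1)]] by (auto simp: runs_def)
  show ?thesis
    unfolding runs_def using exec.Seq[OF c(1) d(1)] c(2) d(2,3) assms(3)
    by (intro exI[of _ "t + u"] exI[of _ s'']) auto
qed

lemma runs_Cond:
  assumes "bval b s \<Longrightarrow> runs c s T Q" and "\<not> bval b s \<Longrightarrow> runs d s T Q" and "1 + bcost b + T \<le> B"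
  shows "runs (Cond b c d) s B Q"
proof (cases "bval b s")
  case True
  obtain t s' where c: "exec c s t s'" "t \<le> T" "Q s'"
    using assms(1)[OF True] by (auto simp: runs_def)
  then show ?thesis
    unfolding runs_def using exec.CondTrue[OF True c(1)] assms(3)
    by (intro exI[of _ "1 + bcost b + t"] exI[of _ s']) auto
next
  case False
  obtain t s' where c: "exec d s t s'" "t \<le> T" "Q s'"
    using assms(2)[OF False] by (auto simp: runs_def)
  then show ?thesis
    unfolding runs_def using exec.CondFalse[OF False c(1)] assms(3)
    by (intro exI[of _ "1 + bcost b + t"] exI[of _ s']) auto
qed

text \<open>For loops whose number \<open>n\<close> of rounds is known. The invariant is indexed by
  the round, and \<open>agree\<close> with the entry state comes for free. The bound
  \<open>T k\<close> may vary with the round, which allows amortised estimates.\<close>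

lemma runs_While:
  fixes n :: nat
  assumes init: "I 0 s"
    and step: "\<And>k s'. k < n \<Longrightarrow> I k s' \<Longrightarrow> agree (writes c) s s' \<Longrightarrow>
      bval b s' \<and> runs c s' (T k) (I (Suc k))"
    and exit: "\<And>s'. I n s' \<Longrightarrow> agree (writes c) s s' \<Longrightarrow> \<not> bval b s'"
    and bound: "(1 + bcost b) * Suc n + (\<Sum>k<n. T k) \<le> B"
  shows "runs (While b c) s B (I n)"
proof -
  \<comment> \<open>Generalised to a loop entered at round \<open>k\<close>, with induction on the
    number \<open>n - k\<close> of remaining rounds.\<close>
  have "I k s' \<Longrightarrow> agree (writes c) s s' \<Longrightarrow>
      runs (While b c) s' ((1 + bcost b) * Suc (n - k) + (\<Sum>j\<in>{k..<n}. T j)) (I n)"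
    if "k \<le> n" for k s'
    using that
  proof (induction "n - k" arbitrary: k s')
    case 0
    then have k: "k = n" by simp
    then show ?case
      using exec.WhileFalse[of b s' c] exit[of s'] 0 by (auto simp: runs_def)
  next
    case (Suc d)
    then have k: "k < n" by simp
    obtain t r where c: "exec c s' t r" "t \<le> T k" "I (Suc k) r" and b: "bval b s'"
      using step[OF k Suc.prems(1,2)] by (auto simp: runs_def)
    have "agree (writes c) s r"
      using agree_trans[OF Suc.prems(2) exec_agree[OF c(1)]] .
    with Suc.hyps(1)[of "Suc k" r] Suc.hyps(2) k c(3) have
      "runs (While b c) r ((1 + bcost b) * Suc (n - Suc k) + (\<Sum>j\<in>{Suc k..<n}. T j)) (I n)"
      by linarith
    then obtain u q where w: "exec (While b c) r u q"
        "u \<le> (1 + bcost b) * Suc (n - Suc k) + (\<Sum>j\<in>{Suc k..<n}. T j)" "I n q"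
      unfolding runs_def by blast
    have "1 + bcost b + t + u \<le> (1 + bcost b) * Suc (n - k) + (\<Sum>j\<in>{k..<n}. T j)"
      using c(2) w(2) k by (simp add: sum.atLeast_Suc_lessThan Suc_diff_Suc[symmetric])
    then show ?case
      unfolding runs_def using exec.WhileTrue[OF b c(1) w(1)] w(3) by blast
  qed
  from this[of 0 s] init have
    "runs (While b c) s ((1 + bcost b) * Suc n + (\<Sum>k<n. T k)) (I n)"
    by (simp add: agree_refl atLeast0LessThan)
  then show ?thesis
    by (rule runs_mono) (use bound in simp_all)
qed

primrec loop_free :: "com \<Rightarrow> bool" where
  "loop_free Skip = True"
| "loop_free (NStore x i a) = True"
| "loop_free (RStore x i a) = True"
| "loop_free (Seq c d) = (loop_free c \<and> loop_free d)"
| "loop_free (Cond b c d) = (loop_free c \<and> loop_free d)"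
| "loop_free (While b c) = False"

text \<open>A denotational semantics of loop-free programs, so that straight-line code is evaluated
  by rewriting. The clause for \<open>While\<close> is a dummy.\<close>

primrec effect :: "com \<Rightarrow> state \<Rightarrow> state" where
  "effect Skip s = s"
| "effect (NStore x i a) s = nstore x (nval i s) (nval a s) s"
| "effect (RStore x i a) s = rstore x (nval i s) (rval a s) s"
| "effect (Seq c d) s = effect d (effect c s)"
| "effect (Cond b c d) s = (if bval b s then effect c s else effect d s)"
| "effect (While b c) s = s"

text \<open>Adding the costs of both branches is crude but keeps the bound a plain sum that
  evaluates to a numeral.\<close>

primrec max_cost :: "com \<Rightarrow> nat" where
  "max_cost Skip = 1"
| "max_cost (NStore x i a) = 1 + ncost i + ncost a"
| "max_cost (RStore x i a) = 1 + ncost i + rcost a"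
| "max_cost (Seq c d) = max_cost c + max_cost d"
| "max_cost (Cond b c d) = 1 + bcost b + max_cost c + max_cost d"
| "max_cost (While b c) = 0"

lemma runs_loop_free:
  assumes "loop_free c" and "max_cost c \<le> T" and "Q (effect c s)"
  shows "runs c s T Q"
proof -
  have "loop_free c \<Longrightarrow> runs c s (max_cost c) (\<lambda>s'. s' = effect c s)" for s
  proof (induction c arbitrary: s)
    case Skip
    then show ?case using exec.Skip by (auto simp: runs_def)
  next
    case (NStore x i a)
    then show ?case using exec.NStore by (fastforce simp: runs_def)
  next
    case (RStore x i a)
    then show ?case using exec.RStore by (fastforce simp: runs_def)
  next
    case (Seq c d)
    then show ?case by (auto intro!: runs_Seq)
  next
    case (Cond b c d)
    have "runs c s (max_cost c + max_cost d) (\<lambda>s'. s' = effect c s)"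
      "runs d s (max_cost c + max_cost d) (\<lambda>s'. s' = effect d s)"
      using Cond.prems by (auto intro: runs_mono[OF Cond.IH(1)] runs_mono[OF Cond.IH(2)])
    then show ?case
      by (auto intro!: runs_Cond[where T = "max_cost c + max_cost d"])
  qed simp
  from this[OF assms(1)] show ?thesis
    by (rule runs_mono) (use assms in auto)
qed

subsection \<open>Sorting by bottom-up mergesort\<close>

fun merge_desc :: "('a \<Rightarrow> real) \<Rightarrow> 'a list \<Rightarrow> 'a list \<Rightarrow> 'a list" where
  "merge_desc f [] ys = ys"
| "merge_desc f xs [] = xs"
| "merge_desc f (x # xs) (y # ys) =
    (if f y \<le> f x then x # merge_desc f xs (y # ys) else y # merge_desc f (x # xs) ys)"

lemma merge_desc_Nil2 [simp]: "merge_desc f xs [] = xs"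
  by (cases xs) auto

lemma mset_merge_desc [simp]: "mset (merge_desc f xs ys) = mset xs + mset ys"
  by (induction f xs ys rule: merge_desc.induct) auto

lemma set_merge_desc [simp]: "set (merge_desc f xs ys) = set xs \<union> set ys"
  by (metis mset_merge_desc set_mset_mset set_mset_union)

abbreviation sorted_desc :: "('a \<Rightarrow> real) \<Rightarrow> 'a list \<Rightarrow> bool" where
  "sorted_desc f \<equiv> sorted_wrt (\<lambda>x y. f y \<le> f x)"

lemma sorted_merge_desc:
  "sorted_desc f xs \<Longrightarrow> sorted_desc f ys \<Longrightarrow> sorted_desc f (merge_desc f xs ys)"
  by (induction f xs ys rule: merge_desc.induct) force+

abbreviation Get :: "string \<Rightarrow> nexp" where
  "Get x \<equiv> NLoad x (NConst 0)"

abbreviation Set :: "string \<Rightarrow> nexp \<Rightarrow> com" where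
  "Set x a \<equiv> NStore x (NConst 0) a"

abbreviation Inc :: "string \<Rightarrow> com" where
  "Inc x \<equiv> Set x (NAdd (Get x) (NConst 1))"

abbreviation NLt :: "nexp \<Rightarrow> nexp \<Rightarrow> bexp" where
  "NLt a b \<equiv> Neg (NLe b a)"

abbreviation key :: "string \<Rightarrow> rexp" where
  "key x \<equiv> RLoad ''value1'' (NLoad ''order'' (Get x))"

text \<open>There is no disjunction in \<open>bexp\<close>, hence the nested negations: the left run
  delivers unless it is exhausted or the head of the right run is strictly larger. Ties go to the
  left, as in \<open>merge_desc\<close>.\<close>

definition merge_step :: com where
  "merge_step =
    Seq (Cond (Conj (NLt (Get ''l'') (Get ''mid''))
          (Neg (Conj (NLt (Get ''r'') (Get ''stop'')) (Neg (RLe (key ''r'') (key ''l''))))))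
        (Seq (NStore ''aux'' (Get ''p'') (NLoad ''order'' (Get ''l''))) (Inc ''l''))
        (Seq (NStore ''aux'' (Get ''p'') (NLoad ''order'' (Get ''r''))) (Inc ''r'')))
      (Inc ''p'')"

definition copy_step :: com where
  "copy_step = Seq (NStore ''order'' (Get ''p'') (NLoad ''aux'' (Get ''p''))) (Inc ''p'')"

definition merge_init :: com where
  "merge_init =
    Seq (Set ''mid'' (NAdd (Get ''i'') (Get ''w'')))
   (Seq (Set ''stop'' (NAdd (Get ''mid'') (Get ''w'')))
   (Seq (Set ''l'' (Get ''i''))
   (Seq (Set ''r'' (Get ''mid''))
        (Set ''p'' (Get ''i'')))))"

definition merge_blocks :: com where
  "merge_blocks =
    Seq merge_init
   (Seq (While (NLt (Get ''p'') (Get ''stop'')) merge_step)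
   (Seq (Set ''p'' (Get ''i''))
   (Seq (While (NLt (Get ''p'') (Get ''stop'')) copy_step)
        (Set ''i'' (Get ''stop'')))))"

lemma writes_merge_blocks:
  "writes merge_blocks = {''mid'', ''stop'', ''l'', ''r'', ''p'', ''aux'', ''order'', ''i''}"
  by (auto simp: merge_blocks_def merge_init_def merge_step_def copy_step_def)

lemma runs_merge_loop:
  assumes "nmem s ''l'' 0 = i" "nmem s ''p'' 0 = i" "nmem s ''r'' 0 = i + w"
    "nmem s ''mid'' 0 = i + w" "nmem s ''stop'' 0 = i + 2 * w"
  shows "runs (While (NLt (Get ''p'') (Get ''stop'')) merge_step) s (200 * w + 100)
    (\<lambda>s'. map (nmem s' ''aux'') [i..<i + 2 * w] =
      merge_desc (rmem s ''value1'') (map (nmem s ''order'') [i..<i + w])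
        (map (nmem s ''order'') [i + w..<i + 2 * w]))"
proof -
  let ?v = "rmem s ''value1''" and ?a = "nmem s ''order''"
  define M where "M = merge_desc ?v (map ?a [i..<i + w]) (map ?a [i + w..<i + 2 * w])"
  \<comment> \<open>The output so far followed by the merge of the two remaining runs is always the
    final result \<open>M\<close>. The equation for \<open>l + r\<close> ties the read positions to
    the write position.\<close>
  define I where "I = (\<lambda>j (s' :: state). \<exists>l r. nmem s' ''l'' 0 = l \<and> nmem s' ''r'' 0 = r \<and>
    nmem s' ''p'' 0 = i + j \<and> l \<le> i + w \<and> r \<le> i + 2 * w \<and> l + r = i + (i + w) + j \<and>
    map (nmem s' ''aux'') [i..<i + j] @
      merge_desc ?v (map ?a [l..<i + w]) (map ?a [r..<i + 2 * w]) = M)"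
  have "runs (While (NLt (Get ''p'') (Get ''stop'')) merge_step) s (200 * w + 100) (I (2 * w))"
  proof (rule runs_While[where T = "\<lambda>_. 80"])
    show "I 0 s"
      using assms by (simp add: I_def M_def)
  next
    fix j s' assume j: "j < 2 * w" and I: "I j s'" and ag: "agree (writes merge_step) s s'"
    have fr: "nmem s' ''order'' = ?a" "nmem s' ''mid'' 0 = i + w" "nmem s' ''stop'' 0 = i + 2 * w"
      "rmem s' ''value1'' = ?v"
      using ag assms by (simp_all add: agree_def merge_step_def)
    obtain l r where lr: "nmem s' ''l'' 0 = l" "nmem s' ''r'' 0 = r"
      "nmem s' ''p'' 0 = i + j" "l \<le> i + w" "r \<le> i + 2 * w" "l + r = i + (i + w) + j"
      "map (nmem s' ''aux'') [i..<i + j] @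
        merge_desc ?v (map ?a [l..<i + w]) (map ?a [r..<i + 2 * w]) = M"
      using I by (auto simp: I_def)
    \<comment> \<open>In each case \<open>upt_conv_Cons\<close> exposes the heads of the nonempty
      runs, and one unfolding of \<open>merge_desc\<close> agrees with the branch that the program
      takes.\<close>
    have "I (Suc j) (effect merge_step s')"
    proof (cases "l < i + w")
      case l: True
      show ?thesis
      proof (cases "r < i + 2 * w")
        case True
        then show ?thesis
          using l lr(7)[symmetric] lr(1-6) fr
          by (simp add: I_def merge_step_def upt_conv_Cons)
      next
        case False
        then show ?thesis
          using l lr(7)[symmetric] lr(1-6) fr
          by (simp add: I_def merge_step_def upt_conv_Cons)
      qed
    next
      case False
      then have "r < i + 2 * w" using lr(4,6) j by linarith
      then show ?thesis
        using False lr(7)[symmetric] lr(1-6) fr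
        by (simp add: I_def merge_step_def upt_conv_Cons)
    qed
    moreover have "bval (NLt (Get ''p'') (Get ''stop'')) s'"
      using fr lr j by simp
    ultimately show "bval (NLt (Get ''p'') (Get ''stop'')) s' \<and> runs merge_step s' 80 (I (Suc j))"
      by (auto intro!: runs_loop_free simp: merge_step_def)
  next
    fix s' assume "I (2 * w) s'" "agree (writes merge_step) s s'"
    then show "\<not> bval (NLt (Get ''p'') (Get ''stop'')) s'"
      using assms by (auto simp: I_def agree_def merge_step_def)
  qed simp
  then show ?thesis
  proof (rule runs_mono)
    fix s' assume "I (2 * w) s'"
    then obtain l r where *: "l \<le> i + w" "r \<le> i + 2 * w" "l + r = i + (i + w) + 2 * w"
      "map (nmem s' ''aux'') [i..<i + 2 * w] @
      merge_desc ?v (map ?a [l..<i + w]) (map ?a [r..<i + 2 * w]) = M"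
      by (auto simp: I_def)
    \<comment> \<open>The sum \<open>l + r\<close> attains its maximum, so both runs are exhausted
      and the remaining merge is empty.\<close>
    then have "l = i + w" "r = i + 2 * w" by linarith+
    then show "map (nmem s' ''aux'') [i..<i + 2 * w] =
      merge_desc ?v (map ?a [i..<i + w]) (map ?a [i + w..<i + 2 * w])"
      using * by (simp add: M_def)
  qed simp
qed

lemma runs_copy_loop:
  assumes "nmem s ''p'' 0 = i" "nmem s ''stop'' 0 = i + n"
  shows "runs (While (NLt (Get ''p'') (Get ''stop'')) copy_step) s (40 * n + 40)
    (\<lambda>s'. nmem s' ''order'' = (\<lambda>k. if i \<le> k \<and> k < i + n then nmem s ''aux'' k else nmem s ''order'' k))"
proof -
  define I where "I = (\<lambda>j (s' :: state). nmem s' ''p'' 0 = i + j \<and>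
    nmem s' ''order'' = (\<lambda>k. if i \<le> k \<and> k < i + j then nmem s ''aux'' k else nmem s ''order'' k))"
  have "runs (While (NLt (Get ''p'') (Get ''stop'')) copy_step) s (40 * n + 40) (I n)"
  proof (rule runs_While[where T = "\<lambda>_. 20"])
    show "I 0 s"
      using assms by (auto simp: I_def)
  next
    fix j s' assume j: "j < n" and I: "I j s'" and ag: "agree (writes copy_step) s s'"
    have fr: "nmem s' ''aux'' = nmem s ''aux''" "nmem s' ''stop'' 0 = i + n"
      using ag assms by (simp_all add: agree_def copy_step_def)
    have "I (Suc j) (effect copy_step s')"
      using fr I by (auto simp: I_def copy_step_def fun_eq_iff)
    moreover have "bval (NLt (Get ''p'') (Get ''stop'')) s'"
      using fr I j by (simp add: I_def)
    ultimately show "bval (NLt (Get ''p'') (Get ''stop'')) s' \<and> runs copy_step s' 20 (I (Suc j))"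
      by (auto intro!: runs_loop_free simp: copy_step_def)
  next
    fix s' assume "I n s'" "agree (writes copy_step) s s'"
    then show "\<not> bval (NLt (Get ''p'') (Get ''stop'')) s'"
      using assms by (auto simp: I_def agree_def copy_step_def)
  qed simp
  then show ?thesis
    by (rule runs_mono) (auto simp: I_def)
qed

lemma runs_merge_blocks:
  assumes "nmem s ''i'' 0 = i" "nmem s ''w'' 0 = w"
  shows "runs merge_blocks s (300 * w + 300)
    (\<lambda>s'. nmem s' ''i'' 0 = i + 2 * w \<and>
      map (nmem s' ''order'') [i..<i + 2 * w] =
        merge_desc (rmem s ''value1'') (map (nmem s ''order'') [i..<i + w])
          (map (nmem s ''order'') [i + w..<i + 2 * w]) \<and>
      (\<forall>k. k < i \<or> i + 2 * w \<le> k \<longrightarrow> nmem s' ''order'' k = nmem s ''order'' k))"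
  unfolding merge_blocks_def
proof (rule runs_Seq[where T = 50 and U = "300 * w + 250"])
  show "runs merge_init s 50 (\<lambda>s'. s' = effect merge_init s)"
    by (rule runs_loop_free) (auto simp: merge_init_def)
  fix s1 assume "s1 = effect merge_init s"
  then have s1: "nmem s1 ''l'' 0 = i" "nmem s1 ''p'' 0 = i" "nmem s1 ''r'' 0 = i + w"
    "nmem s1 ''mid'' 0 = i + w" "nmem s1 ''stop'' 0 = i + 2 * w"
    "nmem s1 ''order'' = nmem s ''order''" "rmem s1 = rmem s" "nmem s1 ''i'' 0 = i"
    using assms by (simp_all add: merge_init_def)
  show "runs (Seq (While (NLt (Get ''p'') (Get ''stop'')) merge_step)
   (Seq (Set ''p'' (Get ''i''))
   (Seq (While (NLt (Get ''p'') (Get ''stop'')) copy_step)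
        (Set ''i'' (Get ''stop''))))) s1 (300 * w + 250)
    (\<lambda>s'. nmem s' ''i'' 0 = i + 2 * w \<and>
      map (nmem s' ''order'') [i..<i + 2 * w] =
        merge_desc (rmem s ''value1'') (map (nmem s ''order'') [i..<i + w])
          (map (nmem s ''order'') [i + w..<i + 2 * w]) \<and>
      (\<forall>k. k < i \<or> i + 2 * w \<le> k \<longrightarrow> nmem s' ''order'' k = nmem s ''order'' k))"
  proof (rule runs_Seq[OF runs_merge_loop[OF s1(1-5)], where U = "100 * w + 150"], goal_cases)
    case (1 s2)
    let ?t = "effect (Set ''p'' (Get ''i'')) s2"
    from 1(2) have s2: "nmem s2 ''i'' 0 = i" "nmem s2 ''stop'' 0 = i + 2 * w"
      "nmem s2 ''order'' = nmem s ''order''"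
      using s1 by (simp_all add: agree_def merge_step_def)
    show ?case
    proof (rule runs_Seq[where T = 10 and U = "80 * w + 100" and Q = "\<lambda>s'. s' = ?t"], goal_cases)
      case 1
      show ?case by (rule runs_loop_free) auto
    next
      case (2 s3)
      have s3: "nmem s3 ''p'' 0 = i" "nmem s3 ''stop'' 0 = i + 2 * w"
        "nmem s3 ''aux'' = nmem s2 ''aux''" "nmem s3 ''order'' = nmem s ''order''"
        using 2 s2 by simp_all
      show ?case
      proof (rule runs_Seq[OF runs_copy_loop[OF s3(1,2)], where U = 20], goal_cases)
        case (1 s4)
        have "map (nmem s4 ''order'') [i..<i + 2 * w] = map (nmem s2 ''aux'') [i..<i + 2 * w]"
          using 1 s3 by simp
        moreover have "nmem s4 ''stop'' 0 = i + 2 * w"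
          using 1 s3 by (simp add: agree_def copy_step_def)
        ultimately show ?case
          using 1(1) \<open>map (nmem s2 ''aux'') _ = _\<close> s1 s3
          by (intro runs_loop_free) auto
      qed simp
    qed simp
  qed simp
qed simp

text \<open>Reduces the claim that a pass permutes the whole array to the one block that a merge
  rewrites.\<close>

lemma mset_map_replace_segment:
  fixes f g :: "nat \<Rightarrow> 'a"
  assumes "i \<le> j" "j \<le> n" "\<And>k. k < i \<or> j \<le> k \<Longrightarrow> g k = f k"
    and "mset (map g [i..<j]) = mset (map f [i..<j])"
  shows "mset (map g [0..<n]) = mset (map f [0..<n])"
proof -
  have "[0..<n] = [0..<i] @ [i..<j] @ [j..<n]"
    using assms(1,2) upt_add_eq_append[of 0 i "n - i"] upt_add_eq_append[of i j "n - j"] by simp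
  moreover have "map g [0..<i] = map f [0..<i]" "map g [j..<n] = map f [j..<n]"
    using assms(3) by auto
  ultimately show ?thesis
    using assms(4) by (metis map_append mset_append)
qed

lemma runs_merge_pass:
  assumes n: "nmem s ''n'' 0 = H * (2 * w)" and w: "nmem s ''w'' 0 = w" "w > 0"
    and i: "nmem s ''i'' 0 = 0"
    and sorted: "\<And>q. q < 2 * H \<Longrightarrow>
      sorted_desc (rmem s ''value1'') (map (nmem s ''order'') [q * w..<q * w + w])"
  shows "runs (While (NLt (Get ''i'') (Get ''n'')) merge_blocks) s (500 * (H * (2 * w)) + 100)
    (\<lambda>s'. (\<forall>q<H. sorted_desc (rmem s ''value1'')
        (map (nmem s' ''order'') [q * (2 * w)..<q * (2 * w) + 2 * w])) \<and>
      mset (map (nmem s' ''order'') [0..<H * (2 * w)]) = mset (map (nmem s ''order'') [0..<H * (2 * w)]))"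
proof -
  let ?v = "rmem s ''value1''" and ?N = "H * (2 * w)"
  \<comment> \<open>Positions from the current block onwards are unchanged, so the assumed
    sortedness of the short runs is still available there.\<close>
  define I where "I = (\<lambda>q (s' :: state). nmem s' ''i'' 0 = q * (2 * w) \<and>
    (\<forall>p<q. sorted_desc ?v (map (nmem s' ''order'') [p * (2 * w)..<p * (2 * w) + 2 * w])) \<and>
    (\<forall>k\<ge>q * (2 * w). nmem s' ''order'' k = nmem s ''order'' k) \<and>
    mset (map (nmem s' ''order'') [0..<?N]) = mset (map (nmem s ''order'') [0..<?N]))"
  have "runs (While (NLt (Get ''i'') (Get ''n'')) merge_blocks) s (500 * ?N + 100) (I H)"
  proof (rule runs_While[where T = "\<lambda>_. 300 * w + 300"])
    show "I 0 s"
      using i by (simp add: I_def)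
  next
    fix q s' assume q: "q < H" and I: "I q s'" and ag: "agree (writes merge_blocks) s s'"
    have fr: "nmem s' ''n'' 0 = ?N" "nmem s' ''w'' 0 = w" "rmem s' ''value1'' = ?v"
      using ag n w by (simp_all add: agree_def writes_merge_blocks)
    let ?i = "q * (2 * w)"
    have le: "?i + 2 * w \<le> ?N"
      using mult_le_mono1[OF Suc_leI[OF q], of "2 * w"] by simp
    have si: "nmem s' ''i'' 0 = ?i"
      using I by (simp add: I_def)
    \<comment> \<open>Block \<open>q\<close> of length \<open>2 * w\<close> consists of the short
      runs with numbers \<open>2 * q\<close> and \<open>2 * q + 1\<close>.\<close>
    have sl: "sorted_desc ?v (map (nmem s' ''order'') [?i..<?i + w])"
    proof -
      have "map (nmem s' ''order'') [?i..<?i + w] = map (nmem s ''order'') [(2 * q) * w..<(2 * q) * w + w]"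
        using I by (auto simp: I_def algebra_simps)
      then show ?thesis using sorted[of "2 * q"] q by simp
    qed
    have sr: "sorted_desc ?v (map (nmem s' ''order'') [?i + w..<?i + 2 * w])"
    proof -
      have "map (nmem s' ''order'') [?i + w..<?i + 2 * w] =
          map (nmem s ''order'') [(2 * q + 1) * w..<(2 * q + 1) * w + w]"
        using I by (auto simp: I_def algebra_simps)
      then show ?thesis using sorted[of "2 * q + 1"] q by simp
    qed
    have "runs merge_blocks s' (300 * w + 300) (I (Suc q))"
    proof (rule runs_mono[OF runs_merge_blocks[OF si fr(2)]])
      fix r :: state
      assume r: "nmem r ''i'' 0 = ?i + 2 * w \<and>
        map (nmem r ''order'') [?i..<?i + 2 * w] =
          merge_desc (rmem s' ''value1'') (map (nmem s' ''order'') [?i..<?i + w])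
            (map (nmem s' ''order'') [?i + w..<?i + 2 * w]) \<and>
        (\<forall>k. k < ?i \<or> ?i + 2 * w \<le> k \<longrightarrow> nmem r ''order'' k = nmem s' ''order'' k)"
      have "sorted_desc ?v (map (nmem r ''order'') [p * (2 * w)..<p * (2 * w) + 2 * w])"
        if "p < Suc q" for p
      proof (cases "p = q")
        case True
        show ?thesis
          using sorted_merge_desc[OF sl sr] r fr(3) unfolding True by metis
      next
        case False
        then have "p < q" using that by simp
        then have "p * (2 * w) + 2 * w \<le> ?i"
          using mult_le_mono1[of "Suc p" q "2 * w"] by simp
        then have "map (nmem r ''order'') [p * (2 * w)..<p * (2 * w) + 2 * w] =
            map (nmem s' ''order'') [p * (2 * w)..<p * (2 * w) + 2 * w]"
          using r by (auto simp del: mult_Suc_right)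
        then show ?thesis
          using I \<open>p < q\<close> unfolding I_def by metis
      qed
      moreover have "mset (map (nmem r ''order'') [0..<?N]) = mset (map (nmem s' ''order'') [0..<?N])"
      proof (rule mset_map_replace_segment[of ?i "?i + 2 * w"])
        have "[?i..<?i + 2 * w] = [?i..<?i + w] @ [?i + w..<?i + 2 * w]"
          using upt_add_eq_append[of ?i "?i + w" w] by (simp add: add.assoc mult_2)
        then show "mset (map (nmem r ''order'') [?i..<?i + 2 * w]) =
            mset (map (nmem s' ''order'') [?i..<?i + 2 * w])"
          unfolding r[THEN conjunct2, THEN conjunct1] by simp
      qed (use r le in auto)
      ultimately show "I (Suc q) r"
        using r I by (simp add: I_def)
    qed simp
    moreover have "bval (NLt (Get ''i'') (Get ''n'')) s'"
      using fr si q w(2) by simp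
    ultimately show "bval (NLt (Get ''i'') (Get ''n'')) s' \<and>
        runs merge_blocks s' (300 * w + 300) (I (Suc q))"
      by simp
  next
    fix s' assume "I H s'" "agree (writes merge_blocks) s s'"
    then show "\<not> bval (NLt (Get ''i'') (Get ''n'')) s'"
      using n by (simp add: I_def agree_def writes_merge_blocks)
  next
    \<comment> \<open>Absorbs the constant overhead of each block into the term that is linear in
      the array length.\<close>
    have "H \<le> H * w" using w(2) by simp
    then show "(1 + bcost (NLt (Get ''i'') (Get ''n''))) * Suc H + (\<Sum>q<H. 300 * w + 300) \<le> 500 * ?N + 100"
      by (simp add: algebra_simps) (use \<open>H \<le> H * w\<close> in linarith)
  qed
  then show ?thesis
    by (rule runs_mono) (simp_all add: I_def)
qed

definition merge_pass :: com where
  "merge_pass =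
    Seq (Set ''i'' (NConst 0))
   (Seq (While (NLt (Get ''i'') (Get ''n'')) merge_blocks)
        (Set ''w'' (NAdd (Get ''w'') (Get ''w''))))"

definition merge_sort :: com where
  "merge_sort =
    Seq (Set ''w'' (NConst 1)) (While (NLt (Get ''w'') (Get ''n'')) merge_pass)"

lemma writes_merge_pass: "writes merge_pass = insert ''w'' (writes merge_blocks)"
  by (auto simp: merge_pass_def writes_merge_blocks)

lemma runs_merge_sort:
  assumes n: "nmem s ''n'' 0 = 2 ^ d"
  shows "runs merge_sort s (700 * 2 ^ d * (d + 1))
    (\<lambda>s'. sorted_desc (rmem s ''value1'') (map (nmem s' ''order'') [0..<2 ^ d]) \<and>
      mset (map (nmem s' ''order'') [0..<2 ^ d]) = mset (map (nmem s ''order'') [0..<2 ^ d]))"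
  unfolding merge_sort_def
proof (rule runs_Seq[where T = 10 and U = "690 * 2 ^ d * (d + 1)"])
  let ?v = "rmem s ''value1''"
  let ?init = "effect (Set ''w'' (NConst 1)) s"
  show "runs (Set ''w'' (NConst 1)) s 10 (\<lambda>s'. s' = ?init)"
    by (rule runs_loop_free) auto
  fix s1 assume s1: "s1 = ?init"
  \<comment> \<open>After \<open>j\<close> passes the array consists of \<open>2 ^ (d - j)\<close>
    sorted runs of length \<open>2 ^ j\<close>; for \<open>j = d\<close> a single run is
    left.\<close>
  define I where "I = (\<lambda>j (s' :: state). nmem s' ''w'' 0 = 2 ^ j \<and>
    (\<forall>q<2 ^ (d - j). sorted_desc ?v (map (nmem s' ''order'') [q * 2 ^ j..<q * 2 ^ j + 2 ^ j])) \<and>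
    mset (map (nmem s' ''order'') [0..<2 ^ d]) = mset (map (nmem s ''order'') [0..<2 ^ d]))"
  have "runs (While (NLt (Get ''w'') (Get ''n'')) merge_pass) s1 (690 * 2 ^ d * (d + 1)) (I d)"
  proof (rule runs_While[where T = "\<lambda>_. 650 * 2 ^ d"])
    show "I 0 s1"
      using s1 by (simp add: I_def)
  next
    fix j s' assume j: "j < d" and I: "I j s'" and ag: "agree (writes merge_pass) s1 s'"
    have fr: "nmem s' ''n'' 0 = 2 ^ d" "rmem s' ''value1'' = ?v"
      using ag n s1 by (simp_all add: agree_def writes_merge_pass writes_merge_blocks)
    \<comment> \<open>The number of pairs of runs that this pass merges.\<close>
    define H :: nat where "H = 2 ^ (d - Suc j)"
    have N: "(2 :: nat) ^ d = H * (2 * 2 ^ j)"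
    proof -
      have "d = (d - Suc j) + Suc j" using j by simp
      then have "(2 :: nat) ^ d = 2 ^ (d - Suc j) * 2 ^ Suc j" by (metis power_add)
      then show ?thesis by (simp add: H_def)
    qed
    have H2: "2 * H = 2 ^ (d - j)"
      using j by (simp add: H_def Suc_diff_Suc flip: power_Suc)
    have "runs merge_pass s' (650 * 2 ^ d) (I (Suc j))"
      unfolding merge_pass_def
    proof (rule runs_Seq[where T = 10 and U = "640 * 2 ^ d" and
          Q = "\<lambda>r. r = effect (Set ''i'' (NConst 0)) s'"], goal_cases)
      case 1
      show ?case by (rule runs_loop_free) auto
    next
      case (2 s2)
      have s2: "nmem s2 ''n'' 0 = H * (2 * 2 ^ j)" "nmem s2 ''w'' 0 = 2 ^ j" "nmem s2 ''i'' 0 = 0"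
        "nmem s2 ''order'' = nmem s' ''order''" "rmem s2 ''value1'' = ?v"
        using fr I N 2 by (simp_all add: I_def)
      have "\<And>q. q < 2 * H \<Longrightarrow>
        sorted_desc (rmem s2 ''value1'') (map (nmem s2 ''order'') [q * 2 ^ j..<q * 2 ^ j + 2 ^ j])"
        using I s2 by (simp add: I_def H2)
      then have "runs (While (NLt (Get ''i'') (Get ''n'')) merge_blocks) s2
        (500 * (H * (2 * 2 ^ j)) + 100)
        (\<lambda>s'. (\<forall>q<H. sorted_desc (rmem s2 ''value1'')
            (map (nmem s' ''order'') [q * (2 * 2 ^ j)..<q * (2 * 2 ^ j) + 2 * 2 ^ j])) \<and>
          mset (map (nmem s' ''order'') [0..<H * (2 * 2 ^ j)]) =
            mset (map (nmem s2 ''order'') [0..<H * (2 * 2 ^ j)]))"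
        using s2 by (intro runs_merge_pass) auto
      then show ?case
      proof (rule runs_Seq[where U = 20], goal_cases)
        case (1 s3)
        have "nmem s3 ''w'' 0 = 2 ^ j"
          using 1(2) s2(2) by (simp add: agree_def writes_merge_blocks)
        with 1(1) s2(4,5) I show ?case
          by (intro runs_loop_free) (auto simp: I_def N H_def mult.commute)
      next
        case 2
        show ?case using one_le_power[of "2 :: nat" d] unfolding N[symmetric] by linarith
      qed
    next
      case 3
      show ?case using one_le_power[of "2 :: nat" d] by simp
    qed
    moreover have "bval (NLt (Get ''w'') (Get ''n'')) s'"
      using fr I j by (simp add: I_def)
    ultimately show "bval (NLt (Get ''w'') (Get ''n'')) s' \<and>
        runs merge_pass s' (650 * 2 ^ d) (I (Suc j))"
      by simp
  next
    fix s' assume "I d s'" "agree (writes merge_pass) s1 s'"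
    then show "\<not> bval (NLt (Get ''w'') (Get ''n'')) s'"
      using n s1 by (simp add: I_def agree_def writes_merge_pass writes_merge_blocks)
  next
    have "d \<le> d * 2 ^ d" by simp
    then show "(1 + bcost (NLt (Get ''w'') (Get ''n''))) * Suc d + (\<Sum>j<d. 650 * 2 ^ d) \<le>
        690 * 2 ^ d * (d + 1)"
      by (simp add: algebra_simps) (use \<open>d \<le> d * 2 ^ d\<close> one_le_power[of "2 :: nat" d] in linarith)
  qed
  then show "runs (While (NLt (Get ''w'') (Get ''n'')) merge_pass) s1 (690 * 2 ^ d * (d + 1))
     (\<lambda>s'. sorted_desc ?v (map (nmem s' ''order'') [0..<2 ^ d]) \<and>
      mset (map (nmem s' ''order'') [0..<2 ^ d]) = mset (map (nmem s ''order'') [0..<2 ^ d]))"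
    by (rule runs_mono) (simp_all add: I_def)
next
  show "10 + 690 * 2 ^ d * (d + 1) \<le> 700 * 2 ^ d * (d + 1)"
    using one_le_power[of "2 :: nat" d] by (simp add: algebra_simps trans_le_add1)
qed

section \<open>Padding to a power of 2 and the initial order\<close>

definition pad :: com where
  "pad = Seq (Set ''n'' (NConst 2))
    (While (NLt (Get ''n'') (Get ''goods'')) (Set ''n'' (NAdd (Get ''n'') (Get ''n''))))"

text \<open>The assumptions characterise \<open>2 ^ Suc d\<close> as the least power of 2 that is at
  least 2 and at least \<open>m\<close>. Starting from 2 guarantees an even number of goods and at
  least one pair even if \<open>m\<close> is 0 or 1.\<close>

lemma runs_pad:
  assumes "nmem s ''goods'' 0 = m" "m \<le> 2 ^ Suc d" "d = 0 \<or> 2 ^ d < m"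
  shows "runs pad s (40 * (d + 1)) (\<lambda>s'. nmem s' ''n'' 0 = 2 ^ Suc d)"
  unfolding pad_def
proof (rule runs_Seq[where T = 10 and U = "30 * (d + 1)"])
  let ?init = "effect (Set ''n'' (NConst 2)) s"
  show "runs (Set ''n'' (NConst 2)) s 10 (\<lambda>s'. s' = ?init)"
    by (rule runs_loop_free) auto
  fix s1 assume s1: "s1 = ?init"
  show "runs (While (NLt (Get ''n'') (Get ''goods'')) (Set ''n'' (NAdd (Get ''n'') (Get ''n'')))) s1
    (30 * (d + 1)) (\<lambda>s'. nmem s' ''n'' 0 = 2 ^ Suc d)"
  proof (rule runs_While[where T = "\<lambda>_. 15" and I = "\<lambda>j s'. nmem s' ''n'' 0 = 2 ^ Suc j"])
    fix j s' assume j: "j < d" "nmem s' ''n'' 0 = 2 ^ Suc j"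
      "agree (writes (Set ''n'' (NAdd (Get ''n'') (Get ''n'')))) s1 s'"
    then have "nmem s' ''goods'' 0 = m" using assms(1) s1 by (simp add: agree_def)
    moreover have "2 ^ Suc j < m"
      using assms(3) j(1) power_increasing[of "Suc j" d "2 :: nat"] by linarith
    ultimately show "bval (NLt (Get ''n'') (Get ''goods'')) s' \<and>
      runs (Set ''n'' (NAdd (Get ''n'') (Get ''n''))) s' 15 (\<lambda>s'. nmem s' ''n'' 0 = 2 ^ Suc (Suc j))"
      using j(2) by (auto intro!: runs_loop_free)
  next
    fix s' assume "nmem s' ''n'' 0 = 2 ^ Suc d"
      "agree (writes (Set ''n'' (NAdd (Get ''n'') (Get ''n'')))) s1 s'"
    then show "\<not> bval (NLt (Get ''n'') (Get ''goods'')) s'"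
      using assms(1,2) s1 by (simp add: agree_def)
  qed (simp_all add: s1)
qed simp

text \<open>Array positions start at 0 and goods at 1, so position \<open>k\<close> receives good
  \<open>k + 1\<close>.\<close>

definition order_step :: com where
  "order_step =
    Seq (NStore ''order'' (Get ''i'') (NAdd (Get ''i'') (NConst 1))) (Inc ''i'')"

definition init_order :: com where
  "init_order = Seq (Set ''i'' (NConst 0)) (While (NLt (Get ''i'') (Get ''n'')) order_step)"

lemma runs_init_order:
  assumes "nmem s ''n'' 0 = n"
  shows "runs init_order s (40 * n + 40) (\<lambda>s'. \<forall>k<n. nmem s' ''order'' k = Suc k)"
  unfolding init_order_def
proof (rule runs_Seq[where T = 10 and U = "40 * n + 30"])
  let ?init = "effect (Set ''i'' (NConst 0)) s"
  show "runs (Set ''i'' (NConst 0)) s 10 (\<lambda>s'. s' = ?init)"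
    by (rule runs_loop_free) auto
  fix s1 assume s1: "s1 = ?init"
  define I where "I = (\<lambda>j (s' :: state). nmem s' ''i'' 0 = j \<and> (\<forall>k<j. nmem s' ''order'' k = Suc k))"
  have "runs (While (NLt (Get ''i'') (Get ''n'')) order_step) s1 (40 * n + 30) (I n)"
  proof (rule runs_While[where T = "\<lambda>_. 20"])
    fix j s' assume j: "j < n" "I j s'" "agree (writes order_step) s1 s'"
    then have "nmem s' ''n'' 0 = n" using assms s1 by (simp add: agree_def order_step_def)
    then show "bval (NLt (Get ''i'') (Get ''n'')) s' \<and> runs order_step s' 20 (I (Suc j))"
      using j by (auto intro!: runs_loop_free simp: I_def order_step_def)
  next
    fix s' assume "I n s'" "agree (writes order_step) s1 s'"
    then show "\<not> bval (NLt (Get ''i'') (Get ''n'')) s'"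
      using assms s1 by (simp add: I_def agree_def order_step_def)
  qed (simp_all add: s1 I_def)
  then show "runs (While (NLt (Get ''i'') (Get ''n'')) order_step) s1 (40 * n + 30)
    (\<lambda>s'. \<forall>k<n. nmem s' ''order'' k = Suc k)"
    by (rule runs_mono) (simp_all add: I_def)
qed simp

subsection \<open>Pairing and greedy orientation\<close>

text \<open>Pair \<open>p\<close> occupies the positions \<open>2 * p\<close> and
  \<open>2 * p + 1\<close> of the sorted array; natural-number expressions can double only by
  addition.\<close>

abbreviation fst_good :: nexp where
  "fst_good \<equiv> NLoad ''order'' (NAdd (Get ''p'') (Get ''p''))"

abbreviation snd_good :: nexp where
  "snd_good \<equiv> NLoad ''order'' (NAdd (NConst 1) (NAdd (Get ''p'') (Get ''p'')))"

abbreviation pairs_left :: bexp where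
  "pairs_left \<equiv> NLt (NAdd (Get ''p'') (Get ''p'')) (Get ''n'')"

definition rank_step :: com where
  "rank_step =
    Seq (NStore ''rank'' fst_good (Get ''p''))
   (Seq (NStore ''rank'' snd_good (Get ''p''))
        (Inc ''p''))"

definition rank_goods :: com where
  "rank_goods = Seq (Set ''p'' (NConst 0)) (While pairs_left rank_step)"

lemma runs_rank_goods:
  assumes n: "nmem s ''n'' 0 = 2 * h" and inj: "inj_on (nmem s ''order'') {..<2 * h}"
  shows "runs rank_goods s (80 * h + 40) (\<lambda>s'. \<forall>k<2 * h. nmem s' ''rank'' (nmem s ''order'' k) = k div 2)"
  unfolding rank_goods_def
proof (rule runs_Seq[where T = 10 and U = "80 * h + 30"])
  let ?a = "nmem s ''order''"
  let ?init = "effect (Set ''p'' (NConst 0)) s"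
  show "runs (Set ''p'' (NConst 0)) s 10 (\<lambda>s'. s' = ?init)"
    by (rule runs_loop_free) auto
  fix s1 assume s1: "s1 = ?init"
  define I where "I = (\<lambda>q (s' :: state). nmem s' ''p'' 0 = q \<and> (\<forall>k<2 * q. nmem s' ''rank'' (?a k) = k div 2))"
  have "runs (While pairs_left rank_step) s1 (80 * h + 30) (I h)"
  proof (rule runs_While[where T = "\<lambda>_. 40"])
    fix q s' assume q: "q < h" and I: "I q s'" and ag: "agree (writes rank_step) s1 s'"
    have fr: "nmem s' ''n'' 0 = 2 * h" "nmem s' ''order'' = ?a"
      using n s1 ag by (simp_all add: agree_def rank_step_def)
    have "I (Suc q) (effect rank_step s')"
    proof -
      \<comment> \<open>By injectivity of \<open>order\<close>, the two stores of this round do not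
        overwrite the rank of a good from an earlier pair.\<close>
      have eq: "?a k = ?a l \<longleftrightarrow> k = l" if "k < 2 * Suc q" "l < 2 * Suc q" for k l
        using inj_on_eq_iff[OF inj] that q by simp
      have rank: "nmem (effect rank_step s') ''rank'' (?a k) = k div 2" if "k < 2 * Suc q" for k
      proof -
        have "k < 2 * q \<or> k = q + q \<or> k = Suc (q + q)" using that by auto
        then show ?thesis
          using eq[of k "q + q"] eq[of k "Suc (q + q)"] that I fr(2)
          by (auto simp: I_def rank_step_def)
      qed
      have "nmem (effect rank_step s') ''p'' 0 = Suc q"
        using I by (simp add: I_def rank_step_def)
      with rank show ?thesis
        unfolding I_def by blast
    qed
    then show "bval pairs_left s' \<and> runs rank_step s' 40 (I (Suc q))"
      using I q fr(1) by (auto intro!: runs_loop_free simp: I_def rank_step_def)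
  next
    fix s' assume "I h s'" "agree (writes rank_step) s1 s'"
    then show "\<not> bval pairs_left s'"
      using n s1 by (simp add: I_def agree_def rank_step_def)
  qed (simp_all add: s1 I_def)
  then show "runs (While pairs_left rank_step) s1 (80 * h + 30)
    (\<lambda>s'. \<forall>k<2 * h. nmem s' ''rank'' (?a k) = k div 2)"
    by (rule runs_mono) (simp_all add: I_def)
qed simp

text \<open>Linked lists of edge indices; a pointer is the index of the edge plus one, and 0 is the
  null pointer.\<close>

fun chain :: "(nat \<Rightarrow> nat) \<Rightarrow> nat \<Rightarrow> nat list \<Rightarrow> bool" where
  "chain f e [] \<longleftrightarrow> e = 0"
| "chain f e (x # xs) \<longleftrightarrow> e = Suc x \<and> chain f (f e) xs"

lemma chain_fun_upd: "k \<notin> set xs \<Longrightarrow> chain (f(Suc k := a)) e xs \<longleftrightarrow> chain f e xs"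
  by (induction xs arbitrary: e) auto

text \<open>Pushes the edge onto the list of the pair it is charged to. The increment precedes the
  last store so that \<open>e\<close> is then the pointer, index plus one, of the pushed
  edge.\<close>

definition bucket_step :: com where
  "bucket_step =
    Seq (Cond (NLe (NLoad ''rank'' (NLoad ''tail'' (Get ''e''))) (NLoad ''rank'' (NLoad ''head'' (Get ''e''))))
        (Set ''p'' (NLoad ''rank'' (NLoad ''head'' (Get ''e''))))
        (Set ''p'' (NLoad ''rank'' (NLoad ''tail'' (Get ''e'')))))
   (Seq (NStore ''next'' (NAdd (Get ''e'') (NConst 1)) (NLoad ''first'' (Get ''p'')))
   (Seq (Inc ''e'')
        (NStore ''first'' (Get ''p'') (Get ''e''))))"

definition fill_buckets :: com where
  "fill_buckets = Seq (Set ''e'' (NConst 0)) (While (NLt (Get ''e'') (Get ''edges'')) bucket_step)"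

text \<open>The pair to which the edge is charged: it is the first round after which the owners of
  both endpoints are final.\<close>

definition bucket_of :: "state \<Rightarrow> nat \<Rightarrow> nat" where
  "bucket_of s e = max (nmem s ''rank'' (nmem s ''tail'' e)) (nmem s ''rank'' (nmem s ''head'' e))"

text \<open>Reversed, because pushing at the front leaves the most recent edge first.\<close>

definition bucket :: "state \<Rightarrow> nat \<Rightarrow> nat \<Rightarrow> nat list" where
  "bucket s n q = filter (\<lambda>e. bucket_of s e = q) (rev [0..<n])"

lemma set_bucket: "set (bucket s n q) = {e. e < n \<and> bucket_of s e = q}"
  by (auto simp: bucket_def)

lemma length_filter_bucket:
  "length (filter Q (bucket s n q)) = card {e. e < n \<and> bucket_of s e = q \<and> Q e}"
proof -
  have "distinct (filter Q (bucket s n q))"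
    by (simp add: bucket_def)
  then have "length (filter Q (bucket s n q)) = card (set (filter Q (bucket s n q)))"
    by (simp only: distinct_card)
  also have "set (filter Q (bucket s n q)) = {e. e < n \<and> bucket_of s e = q \<and> Q e}"
    by (auto simp: set_bucket)
  finally show ?thesis .
qed

lemma length_bucket: "length (bucket s n q) = card {e. e < n \<and> bucket_of s e = q}"
  using length_filter_bucket[of "\<lambda>_. True" s n q] by simp

lemma runs_fill_buckets:
  assumes n: "nmem s ''edges'' 0 = n" and first: "nmem s ''first'' = (\<lambda>_. 0)"
  shows "runs fill_buckets s (100 * n + 40)
    (\<lambda>s'. \<forall>q. chain (nmem s' ''next'') (nmem s' ''first'' q) (bucket s n q))"
  unfolding fill_buckets_def
proof (rule runs_Seq[where T = 10 and U = "100 * n + 30"])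
  let ?init = "effect (Set ''e'' (NConst 0)) s"
  show "runs (Set ''e'' (NConst 0)) s 10 (\<lambda>s'. s' = ?init)"
    by (rule runs_loop_free) auto
  fix s1 assume s1: "s1 = ?init"
  define I where "I = (\<lambda>j (s' :: state). nmem s' ''e'' 0 = j \<and>
    (\<forall>q. chain (nmem s' ''next'') (nmem s' ''first'' q) (bucket s j q)))"
  have "runs (While (NLt (Get ''e'') (Get ''edges'')) bucket_step) s1 (100 * n + 30) (I n)"
  proof (rule runs_While[where T = "\<lambda>_. 60"])
    fix j s' assume j: "j < n" and I: "I j s'" and ag: "agree (writes bucket_step) s1 s'"
    have fr: "nmem s' ''edges'' 0 = n" "nmem s' ''rank'' = nmem s ''rank''"
      "nmem s' ''tail'' = nmem s ''tail''" "nmem s' ''head'' = nmem s ''head''"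
      using n s1 ag by (simp_all add: agree_def bucket_step_def)
    have e: "nmem s' ''e'' 0 = j" using I by (simp add: I_def)
    let ?t = "effect bucket_step s'"
    have t: "nmem ?t ''e'' 0 = Suc j"
      "nmem ?t ''next'' = (nmem s' ''next'')(Suc j := nmem s' ''first'' (bucket_of s j))"
      "nmem ?t ''first'' = (nmem s' ''first'')(bucket_of s j := Suc j)"
      using e fr by (auto simp: bucket_step_def bucket_of_def max_def)
    have "chain (nmem ?t ''next'') (nmem ?t ''first'' q) (bucket s (Suc j) q)" for q
    proof -
      have "j \<notin> set (bucket s j q)" by (simp add: set_bucket)
      moreover have "chain (nmem s' ''next'') (nmem s' ''first'' q) (bucket s j q)"
        using I by (simp add: I_def)
      moreover have "bucket s (Suc j) q = (if bucket_of s j = q then [j] else []) @ bucket s j q"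
        by (simp add: bucket_def)
      ultimately show ?thesis
        unfolding t by (auto simp: chain_fun_upd)
    qed
    then have "I (Suc j) ?t" using t(1) by (simp add: I_def)
    then show "bval (NLt (Get ''e'') (Get ''edges'')) s' \<and> runs bucket_step s' 60 (I (Suc j))"
      using j fr(1) e by (auto intro!: runs_loop_free simp: bucket_step_def)
  next
    fix s' assume "I n s'" "agree (writes bucket_step) s1 s'"
    then show "\<not> bval (NLt (Get ''e'') (Get ''edges'')) s'"
      using n s1 by (simp add: I_def agree_def bucket_step_def)
  qed (simp_all add: s1 I_def bucket_def first)
  then show "runs (While (NLt (Get ''e'') (Get ''edges'')) bucket_step) s1 (100 * n + 30)
    (\<lambda>s'. \<forall>q. chain (nmem s' ''next'') (nmem s' ''first'' q) (bucket s n q))"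
    by (rule runs_mono) (simp_all add: I_def)
qed simp

section \<open>Orientation of the pairs\<close>

abbreviation end_owner :: "string \<Rightarrow> nexp" where
  "end_owner x \<equiv> NLoad ''owner'' (NLoad x (NSub (Get ''e'') (NConst 1)))"

text \<open>Here \<open>e\<close> holds a pointer, so \<open>end_owner\<close> subtracts 1 to get
  the edge index. Equality of owners is expressed by two inequalities, as \<open>bexp\<close> has no
  equality test.\<close>

definition count_step :: com where
  "count_step =
    Seq (Cond (Conj (NLe (end_owner ''tail'') (end_owner ''head''))
                    (NLe (end_owner ''head'') (end_owner ''tail'')))
          (Inc ''same'') (Inc ''diff''))
      (Set ''e'' (NLoad ''next'' (Get ''e'')))"

text \<open>The owners are a separate argument, so that the same edges can be judged under both
  orientations of a pair and under the final assignment.\<close>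

definition monochromatic :: "state \<Rightarrow> (nat \<Rightarrow> nat) \<Rightarrow> nat \<Rightarrow> bool" where
  "monochromatic s f e \<longleftrightarrow> f (nmem s ''tail'' e) = f (nmem s ''head'' e)"

text \<open>The cost is linear in the length of the traversed list; summed over disjoint buckets
  this stays linear in the number of edges.\<close>

lemma runs_count_loop:
  assumes c: "chain (nmem s ''next'') (nmem s ''e'' 0) xs"
    and z: "nmem s ''same'' 0 = 0" "nmem s ''diff'' 0 = 0"
  shows "runs (While (NLt (NConst 0) (Get ''e'')) count_step) s (100 * length xs + 20)
    (\<lambda>s'. nmem s' ''same'' 0 = length (filter (monochromatic s (nmem s ''owner'')) xs) \<and>
      nmem s' ''diff'' 0 = length (filter (\<lambda>e. \<not> monochromatic s (nmem s ''owner'') e) xs))"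
proof -
  let ?M = "monochromatic s (nmem s ''owner'')"
  define I where "I = (\<lambda>j (s' :: state). chain (nmem s ''next'') (nmem s' ''e'' 0) (drop j xs) \<and>
    nmem s' ''same'' 0 = length (filter ?M (take j xs)) \<and>
    nmem s' ''diff'' 0 = length (filter (\<lambda>e. \<not> ?M e) (take j xs)))"
  have "runs (While (NLt (NConst 0) (Get ''e'')) count_step) s (100 * length xs + 20) (I (length xs))"
  proof (rule runs_While[where T = "\<lambda>_. 60"])
    fix j s' assume j: "j < length xs" and I: "I j s'" and ag: "agree (writes count_step) s s'"
    have fr: "nmem s' ''next'' = nmem s ''next''" "nmem s' ''owner'' = nmem s ''owner''"
      "nmem s' ''tail'' = nmem s ''tail''" "nmem s' ''head'' = nmem s ''head''"
      using ag by (simp_all add: agree_def count_step_def)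
    have e: "nmem s' ''e'' 0 = Suc (xs ! j)" "chain (nmem s ''next'') (nmem s ''next'' (Suc (xs ! j))) (drop (Suc j) xs)"
      using I j by (auto simp: I_def Cons_nth_drop_Suc[symmetric])
    have "?M (xs ! j) \<longleftrightarrow> bval (Conj (NLe (end_owner ''tail'') (end_owner ''head''))
                    (NLe (end_owner ''head'') (end_owner ''tail''))) s'"
      using e fr by (auto simp: monochromatic_def)
    then have "I (Suc j) (effect count_step s')"
      using I j e fr by (auto simp: I_def count_step_def take_Suc_conv_app_nth)
    then show "bval (NLt (NConst 0) (Get ''e'')) s' \<and> runs count_step s' 60 (I (Suc j))"
      using e by (auto intro!: runs_loop_free simp: count_step_def)
  qed (use c z in \<open>simp_all add: I_def\<close>)
  then show ?thesis
    by (rule runs_mono) (simp_all add: I_def)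
qed

definition orient_init :: com where
  "orient_init =
    Seq (NStore ''owner'' fst_good (NConst 1))
   (Seq (NStore ''owner'' snd_good (NConst 2))
   (Seq (Set ''same'' (NConst 0))
   (Seq (Set ''diff'' (NConst 0))
        (Set ''e'' (NLoad ''first'' (Get ''p''))))))"

definition orient_flip :: com where
  "orient_flip =
    Seq (Cond (NLe (Get ''same'') (Get ''diff'')) Skip
          (Seq (NStore ''owner'' fst_good (NConst 2)) (NStore ''owner'' snd_good (NConst 1))))
        (Inc ''p'')"

definition orient_step :: com where
  "orient_step =
    Seq orient_init (Seq (While (NLt (NConst 0) (Get ''e'')) count_step) orient_flip)"

lemma writes_orient_step:
  "writes orient_step = {''owner'', ''same'', ''diff'', ''e'', ''p''}"
  by (auto simp: orient_step_def orient_init_def orient_flip_def count_step_def)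

lemma runs_orient_step:
  assumes p: "nmem s ''p'' 0 = p" and c: "chain (nmem s ''next'') (nmem s ''first'' p) xs"
  defines "x \<equiv> nmem s ''order'' (2 * p)" and "y \<equiv> nmem s ''order'' (Suc (2 * p))"
  defines "f \<equiv> (nmem s ''owner'')(x := 1, y := 2)"
  shows "runs orient_step s (100 * length xs + 200)
    (\<lambda>s'. nmem s' ''p'' 0 = Suc p \<and> nmem s' ''owner'' =
      (if length (filter (monochromatic s f) xs) \<le> length (filter (\<lambda>e. \<not> monochromatic s f e) xs)
       then f else f(x := 2, y := 1)))"
  unfolding orient_step_def
proof (rule runs_Seq[where T = 70 and U = "100 * length xs + 130"])
  show "runs orient_init s 70 (\<lambda>s'. s' = effect orient_init s)"
    by (rule runs_loop_free) (auto simp: orient_init_def)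
  fix s1 assume s1: "s1 = effect orient_init s"
  have fr: "nmem s1 ''owner'' = f" "nmem s1 ''same'' 0 = 0" "nmem s1 ''diff'' 0 = 0"
    "chain (nmem s1 ''next'') (nmem s1 ''e'' 0) xs" "nmem s1 ''p'' 0 = p"
    "nmem s1 ''order'' = nmem s ''order''" "nmem s1 ''tail'' = nmem s ''tail''"
    "nmem s1 ''head'' = nmem s ''head''"
    using p c by (simp_all add: s1 orient_init_def f_def x_def y_def mult_2)
  have M: "monochromatic s1 f = monochromatic s f"
    using fr by (auto simp: monochromatic_def)
  show "runs (Seq (While (NLt (NConst 0) (Get ''e'')) count_step) orient_flip) s1 (100 * length xs + 130)
    (\<lambda>s'. nmem s' ''p'' 0 = Suc p \<and> nmem s' ''owner'' =
      (if length (filter (monochromatic s f) xs) \<le> length (filter (\<lambda>e. \<not> monochromatic s f e) xs)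
       then f else f(x := 2, y := 1)))"
  proof (rule runs_Seq[OF runs_count_loop[OF fr(4,2,3)], where U = 110], goal_cases)
    case (1 s2)
    have "nmem s2 ''owner'' = f" "nmem s2 ''p'' 0 = p" "nmem s2 ''order'' = nmem s ''order''"
      using 1(2) fr by (simp_all add: agree_def count_step_def)
    with 1(1) show ?case
      unfolding fr M
      by (intro runs_loop_free) (auto simp: orient_flip_def x_def y_def mult_2)
  qed simp
qed simp

definition orient_pairs :: com where
  "orient_pairs = Seq (Set ''p'' (NConst 0)) (While pairs_left orient_step)"

lemma runs_orient_pairs:
  assumes n: "nmem s ''n'' 0 = 2 * h"
    and inj: "inj_on (nmem s ''order'') {..<2 * h}"
    and rank: "\<And>k. k < 2 * h \<Longrightarrow> nmem s ''rank'' (nmem s ''order'' k) = k div 2"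
    and chains: "\<And>q. chain (nmem s ''next'') (nmem s ''first'' q) (bucket s c q)"
    and ends: "\<And>e. e < c \<Longrightarrow> nmem s ''tail'' e \<noteq> nmem s ''head'' e \<and>
      nmem s ''tail'' e \<in> nmem s ''order'' ` {..<2 * h} \<and> nmem s ''head'' e \<in> nmem s ''order'' ` {..<2 * h}"
  shows "runs orient_pairs s (300 * h + 100 * c + 50)
    (\<lambda>s'. (\<forall>q<h. {nmem s' ''owner'' (nmem s ''order'' (2 * q)), nmem s' ''owner'' (nmem s ''order'' (Suc (2 * q)))} = {1, 2}) \<and>
      2 * card {e. e < c \<and> monochromatic s (nmem s' ''owner'') e} \<le> c)"
  unfolding orient_pairs_def
proof (rule runs_Seq[where T = 10 and U = "300 * h + 100 * c + 40"])
  let ?a = "nmem s ''order''" and ?t = "nmem s ''tail''" and ?h = "nmem s ''head''"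
  let ?B = "bucket_of s"
  let ?init = "effect (Set ''p'' (NConst 0)) s"
  show "runs (Set ''p'' (NConst 0)) s 10 (\<lambda>s'. s' = ?init)"
    by (rule runs_loop_free) auto
  fix s1 assume s1: "s1 = ?init"
  \<comment> \<open>Every edge is charged to one of the \<open>h\<close> pairs, so at the end the
    invariant speaks about all edges.\<close>
  have B_less: "?B e < h" if e: "e < c" for e
  proof -
    obtain k l where "k < 2 * h" "?t e = ?a k" "l < 2 * h" "?h e = ?a l"
      using ends[OF e] by blast
    then show ?thesis using rank by (simp add: bucket_of_def less_mult_imp_div_less mult.commute)
  qed
  define V where "V = (\<lambda>f q. {e. e < c \<and> ?B e < q \<and> monochromatic s f e})"
  \<comment> \<open>At most half of the edges charged to the first \<open>q\<close> pairs are
    violated; edges with a later charge are not yet counted.\<close>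
  define I where "I = (\<lambda>q (s' :: state). nmem s' ''p'' 0 = q \<and>
    (\<forall>p<q. {nmem s' ''owner'' (?a (2 * p)), nmem s' ''owner'' (?a (Suc (2 * p)))} = {1, 2}) \<and>
    2 * card (V (nmem s' ''owner'') q) \<le> card {e. e < c \<and> ?B e < q})"
  have "runs (While pairs_left orient_step) s1 (300 * h + 100 * c + 40) (I h)"
  proof (rule runs_While[where T = "\<lambda>q. 100 * length (bucket s c q) + 200"])
    fix q s' assume q: "q < h" and I: "I q s'" and ag: "agree (writes orient_step) s1 s'"
    have fr: "nmem s' ''n'' 0 = 2 * h" "nmem s' ''order'' = ?a" "nmem s' ''next'' = nmem s ''next''"
      "nmem s' ''first'' = nmem s ''first''" "nmem s' ''tail'' = ?t" "nmem s' ''head'' = ?h"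
      using n s1 ag by (simp_all add: agree_def writes_orient_step)
    have p: "nmem s' ''p'' 0 = q" using I by (simp add: I_def)
    define x where "x = ?a (2 * q)"
    define y where "y = ?a (Suc (2 * q))"
    define g where "g = (nmem s' ''owner'')(x := 1, y := 2)"
    define S where "S = {e. e < c \<and> ?B e = q \<and> monochromatic s g e}"
    define D where "D = {e. e < c \<and> ?B e = q \<and> \<not> monochromatic s g e}"
    have M: "monochromatic s' = monochromatic s"
      using fr by (auto simp: monochromatic_def fun_eq_iff)
    have xy: "x \<noteq> y" "\<And>k. k < 2 * q \<Longrightarrow> ?a k \<noteq> x \<and> ?a k \<noteq> y"
      using q by (auto simp: x_def y_def dest!: inj_onD[OF inj])
    have "chain (nmem s' ''next'') (nmem s' ''first'' q) (bucket s c q)"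
      using chains fr by simp
    note step = runs_orient_step[OF p this, unfolded fr(2) M, folded x_def y_def, folded g_def,
        unfolded length_filter_bucket, folded S_def D_def]
    have "runs orient_step s' (100 * length (bucket s c q) + 200) (I (Suc q))"
    proof (rule runs_mono[OF step order_refl])
      fix r :: state
      assume r: "nmem r ''p'' 0 = Suc q \<and> nmem r ''owner'' = (if card S \<le> card D then g else g(x := 2, y := 1))"
      let ?f = "nmem r ''owner''"
      have same: "?f (?a k) = nmem s' ''owner'' (?a k)" if "k < 2 * q" for k
        using xy(2)[OF that] r by (simp add: g_def)
      have own: "{?f (?a (2 * p)), ?f (?a (Suc (2 * p)))} = {1, 2}" if "p < Suc q" for p
      proof (cases "p = q")
        case True
        then show ?thesis using r xy(1) by (auto simp: g_def simp flip: x_def y_def)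
      next
        case False
        then have "p < q" using that by simp
        then show ?thesis using I same[of "2 * p"] same[of "Suc (2 * p)"] by (simp add: I_def)
      qed
      have index: "\<exists>k l. ?t e = ?a k \<and> ?h e = ?a l \<and> k < 2 * h \<and> l < 2 * h \<and> ?B e = max (k div 2) (l div 2)"
        if e: "e < c" for e
      proof -
        obtain k l where "k < 2 * h" "?t e = ?a k" "l < 2 * h" "?h e = ?a l"
          using ends[OF e] by blast
        then show ?thesis
          using rank by (intro exI[of _ k] exI[of _ l]) (simp add: bucket_of_def)
      qed
      \<comment> \<open>The charge is the maximum of the two ranks, so an edge charged before round
        \<open>q\<close> has both endpoints in earlier pairs and this round does not affect
        it.\<close>
      have Vq: "V ?f q = V (nmem s' ''owner'') q"
      proof -
        have "monochromatic s ?f e \<longleftrightarrow> monochromatic s (nmem s' ''owner'') e" if e: "e < c" "?B e < q" for e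
        proof -
          obtain k l where "?t e = ?a k" "?h e = ?a l" "?B e = max (k div 2) (l div 2)"
            using index[OF e(1)] by blast
          moreover from this e(2) have "k < 2 * q" "l < 2 * q" by auto
          ultimately show ?thesis using same by (simp add: monochromatic_def)
        qed
        then show ?thesis by (auto simp: V_def)
      qed
      \<comment> \<open>If the orientation is kept, the new violations are \<open>S\<close>, the
        smaller set. If it is swapped, they lie in \<open>D\<close>: an edge inside the pair is
        never violated, and an edge with one endpoint in the pair cannot be violated under both
        orientations, since only that endpoint changes its owner.\<close>
      have new: "2 * card {e. e < c \<and> ?B e = q \<and> monochromatic s ?f e} \<le> card S + card D"
      proof (cases "card S \<le> card D")
        case True
        then show ?thesis using r by (simp add: S_def)
      next
        case False
        then have f: "?f = g(x := 2, y := 1)" using r by simp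
        have "\<not> monochromatic s g e" if e: "e < c" "?B e = q" and m: "monochromatic s ?f e" for e
        proof -
          obtain k l where kl: "?t e = ?a k" "?h e = ?a l" "k < 2 * h" "l < 2 * h"
            "?B e = max (k div 2) (l div 2)"
            using index[OF e(1)] by blast
          have "k div 2 = q \<or> l div 2 = q" using kl(5) e(2) by linarith
          then have "k = 2 * q \<or> k = Suc (2 * q) \<or> l = 2 * q \<or> l = Suc (2 * q)" by linarith
          then have "?t e \<in> {x, y} \<or> ?h e \<in> {x, y}" using kl by (auto simp: x_def y_def)
          then show ?thesis
            using m ends[OF e(1)] xy(1) by (auto simp: monochromatic_def f g_def split: if_splits)
        qed
        then have "{e. e < c \<and> ?B e = q \<and> monochromatic s ?f e} \<subseteq> D" by (auto simp: D_def)
        then have "card {e. e < c \<and> ?B e = q \<and> monochromatic s ?f e} \<le> card D"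
          by (rule card_mono[rotated]) (simp add: D_def)
        then show ?thesis using False by simp
      qed
      have "card (V ?f (Suc q)) = card (V ?f q) + card {e. e < c \<and> ?B e = q \<and> monochromatic s ?f e}"
      proof -
        have "V ?f (Suc q) = V ?f q \<union> {e. e < c \<and> ?B e = q \<and> monochromatic s ?f e}"
          by (auto simp: V_def)
        then show ?thesis by (simp add: card_Un_disjoint V_def disjoint_iff)
      qed
      moreover have "card {e. e < c \<and> ?B e < Suc q} = card {e. e < c \<and> ?B e < q} + (card S + card D)"
      proof -
        have "{e. e < c \<and> ?B e < Suc q} = {e. e < c \<and> ?B e < q} \<union> (S \<union> D)"
          by (auto simp: S_def D_def)
        moreover have "card (S \<union> D) = card S + card D"
          by (rule card_Un_disjoint) (auto simp: S_def D_def)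
        ultimately show ?thesis
          by (simp add: card_Un_disjoint disjoint_iff S_def D_def)
      qed
      moreover have "2 * card (V (nmem s' ''owner'') q) \<le> card {e. e < c \<and> ?B e < q}"
        using I by (simp add: I_def)
      ultimately have "2 * card (V ?f (Suc q)) \<le> card {e. e < c \<and> ?B e < Suc q}"
        using new Vq by simp
      then show "I (Suc q) r"
        unfolding I_def using r own by blast
    qed
    then show "bval pairs_left s' \<and> runs orient_step s' (100 * length (bucket s c q) + 200) (I (Suc q))"
      using q p fr(1) by simp
  next
    fix s' assume "I h s'" "agree (writes orient_step) s1 s'"
    then show "\<not> bval pairs_left s'"
      using n s1 by (simp add: I_def agree_def writes_orient_step)
  next
    \<comment> \<open>The buckets partition the edges, so the varying costs of the rounds add up to
      a bound linear in \<open>h\<close> and \<open>c\<close>.\<close>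
    have "(\<Sum>q<h. length (bucket s c q)) = card (\<Union>q<h. {e. e < c \<and> ?B e = q})"
      unfolding length_bucket by (rule card_UN_disjoint[symmetric]) auto
    also have "(\<Union>q<h. {e. e < c \<and> ?B e = q}) = {..<c}"
      using B_less by auto
    finally have "(\<Sum>q<h. length (bucket s c q)) = c" by simp
    then show "(1 + bcost pairs_left) * Suc h + (\<Sum>q<h. 100 * length (bucket s c q) + 200) \<le>
        300 * h + 100 * c + 40"
      by (simp add: sum.distrib flip: sum_distrib_left)
  qed (simp add: s1 I_def V_def)
  then show "runs (While pairs_left orient_step) s1 (300 * h + 100 * c + 40)
    (\<lambda>s'. (\<forall>q<h. {nmem s' ''owner'' (?a (2 * q)), nmem s' ''owner'' (?a (Suc (2 * q)))} = {1, 2}) \<and>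
      2 * card {e. e < c \<and> monochromatic s (nmem s' ''owner'') e} \<le> c)"
  proof (rule runs_mono)
    fix s' assume I: "I h s'"
    have "{e. e < c \<and> ?B e < h} = {..<c}" "V (nmem s' ''owner'') h = {e. e < c \<and> monochromatic s (nmem s' ''owner'') e}"
      using B_less by (auto simp: V_def)
    then show "(\<forall>q<h. {nmem s' ''owner'' (?a (2 * q)), nmem s' ''owner'' (?a (Suc (2 * q)))} = {1, 2}) \<and>
      2 * card {e. e < c \<and> monochromatic s (nmem s' ''owner'') e} \<le> c"
      using I by (simp add: I_def)
  qed simp
qed simp

subsection \<open>The choice of the second agent\<close>

text \<open>\<open>balance\<close> accumulates the value of bundle 1 minus that of bundle 2 for
  agent 2. The counter is incremented first because goods are numbered from 1.\<close>

definition balance_step :: com where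
  "balance_step =
    Seq (Inc ''i'')
        (Cond (NLe (NLoad ''owner'' (Get ''i'')) (NConst 1))
          (RStore ''balance'' (NConst 0) (RAdd (RLoad ''balance'' (NConst 0)) (RLoad ''value2'' (Get ''i''))))
          (RStore ''balance'' (NConst 0) (RSub (RLoad ''balance'' (NConst 0)) (RLoad ''value2'' (Get ''i'')))))"

definition compute_balance :: com where
  "compute_balance =
    Seq (Set ''i'' (NConst 0)) (While (NLt (Get ''i'') (Get ''goods'')) balance_step)"

lemma runs_compute_balance:
  assumes m: "nmem s ''goods'' 0 = m" and z: "rmem s ''balance'' 0 = 0"
  shows "runs compute_balance s (60 * m + 40) (\<lambda>s'. rmem s' ''balance'' 0 =
    (\<Sum>g = 1..m. if nmem s ''owner'' g \<le> 1 then rmem s ''value2'' g else - rmem s ''value2'' g))"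
  unfolding compute_balance_def
proof (rule runs_Seq[where T = 10 and U = "60 * m + 30"])
  let ?init = "effect (Set ''i'' (NConst 0)) s"
  let ?v = "\<lambda>g. if nmem s ''owner'' g \<le> 1 then rmem s ''value2'' g else - rmem s ''value2'' g"
  show "runs (Set ''i'' (NConst 0)) s 10 (\<lambda>s'. s' = ?init)"
    by (rule runs_loop_free) auto
  fix s1 assume s1: "s1 = ?init"
  define I where "I = (\<lambda>j (s' :: state). nmem s' ''i'' 0 = j \<and> rmem s' ''balance'' 0 = (\<Sum>g = 1..j. ?v g))"
  have "runs (While (NLt (Get ''i'') (Get ''goods'')) balance_step) s1 (60 * m + 30) (I m)"
  proof (rule runs_While[where T = "\<lambda>_. 50"])
    fix j s' assume j: "j < m" "I j s'" "agree (writes balance_step) s1 s'"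
    then have fr: "nmem s' ''goods'' 0 = m" "nmem s' ''owner'' = nmem s ''owner''"
      "rmem s' ''value2'' = rmem s ''value2''"
      using m s1 by (simp_all add: agree_def balance_step_def)
    have "I (Suc j) (effect balance_step s')"
      using j(2) fr by (auto simp: I_def balance_step_def)
    then show "bval (NLt (Get ''i'') (Get ''goods'')) s' \<and> runs balance_step s' 50 (I (Suc j))"
      using j fr by (auto intro!: runs_loop_free simp: I_def balance_step_def)
  next
    fix s' assume "I m s'" "agree (writes balance_step) s1 s'"
    then show "\<not> bval (NLt (Get ''i'') (Get ''goods'')) s'"
      using m s1 by (simp add: I_def agree_def balance_step_def)
  qed (simp_all add: s1 I_def z)
  then show "runs (While (NLt (Get ''i'') (Get ''goods'')) balance_step) s1 (60 * m + 30)
    (\<lambda>s'. rmem s' ''balance'' 0 = (\<Sum>g = 1..m. ?v g))"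
    by (rule runs_mono) (simp_all add: I_def)
qed simp

text \<open>Subtraction from 3 exchanges the owners 1 and 2.\<close>

definition swap_step :: com where
  "swap_step =
    Seq (Inc ''i'')
        (NStore ''owner'' (Get ''i'') (NSub (NConst 3) (NLoad ''owner'' (Get ''i''))))"

definition swap_bundles :: com where
  "swap_bundles =
    Seq (Set ''i'' (NConst 0)) (While (NLt (Get ''i'') (Get ''goods'')) swap_step)"

lemma runs_swap_bundles:
  assumes m: "nmem s ''goods'' 0 = m"
  shows "runs swap_bundles s (60 * m + 40) (\<lambda>s'. \<forall>g\<in>{1..m}. nmem s' ''owner'' g = 3 - nmem s ''owner'' g)"
  unfolding swap_bundles_def
proof (rule runs_Seq[where T = 10 and U = "60 * m + 30"])
  let ?init = "effect (Set ''i'' (NConst 0)) s"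
  show "runs (Set ''i'' (NConst 0)) s 10 (\<lambda>s'. s' = ?init)"
    by (rule runs_loop_free) auto
  fix s1 assume s1: "s1 = ?init"
  define I where "I = (\<lambda>j (s' :: state). nmem s' ''i'' 0 = j \<and>
    (\<forall>g. nmem s' ''owner'' g = (if g \<in> {1..j} then 3 - nmem s ''owner'' g else nmem s ''owner'' g)))"
  have "runs (While (NLt (Get ''i'') (Get ''goods'')) swap_step) s1 (60 * m + 30) (I m)"
  proof (rule runs_While[where T = "\<lambda>_. 50"])
    fix j s' assume j: "j < m" "I j s'" "agree (writes swap_step) s1 s'"
    then have fr: "nmem s' ''goods'' 0 = m"
      using m s1 by (simp_all add: agree_def swap_step_def)
    have "I (Suc j) (effect swap_step s')"
      using j(2) by (auto simp: I_def swap_step_def)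
    then show "bval (NLt (Get ''i'') (Get ''goods'')) s' \<and> runs swap_step s' 50 (I (Suc j))"
      using j fr by (auto intro!: runs_loop_free simp: I_def swap_step_def)
  next
    fix s' assume "I m s'" "agree (writes swap_step) s1 s'"
    then show "\<not> bval (NLt (Get ''i'') (Get ''goods'')) s'"
      using m s1 by (simp add: I_def agree_def swap_step_def)
  qed (simp_all add: s1 I_def)
  then show "runs (While (NLt (Get ''i'') (Get ''goods'')) swap_step) s1 (60 * m + 30)
    (\<lambda>s'. \<forall>g\<in>{1..m}. nmem s' ''owner'' g = 3 - nmem s ''owner'' g)"
    by (rule runs_mono) (simp_all add: I_def)
qed simp

definition choose_bundle :: com where
  "choose_bundle =
    Seq compute_balance (Cond (RLe (RConst 0) (RLoad ''balance'' (NConst 0))) swap_bundles Skip)"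

text \<open>The first conjunct keeps the unordered partition, and with it the violations and the
  guarantee for agent 1. The second makes agent 2 envy-free.\<close>

lemma runs_choose_bundle:
  assumes m: "nmem s ''goods'' 0 = m" and z: "rmem s ''balance'' 0 = 0"
    and own: "\<And>g. g \<in> {1..m} \<Longrightarrow> nmem s ''owner'' g \<in> {1, 2}"
  shows "runs choose_bundle s (120 * m + 100) (\<lambda>s'.
    ((\<forall>g\<in>{1..m}. nmem s' ''owner'' g = nmem s ''owner'' g) \<or>
      (\<forall>g\<in>{1..m}. nmem s' ''owner'' g = 3 - nmem s ''owner'' g)) \<and>
    sum (rmem s ''value2'') {g\<in>{1..m}. nmem s' ''owner'' g = 1} \<le>
      sum (rmem s ''value2'') {g\<in>{1..m}. nmem s' ''owner'' g = 2})"
  unfolding choose_bundle_def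
proof (rule runs_Seq[OF runs_compute_balance[OF m z], where U = "60 * m + 60"])
  let ?v = "rmem s ''value2''" and ?f = "nmem s ''owner''"
  fix s1
  assume bal: "rmem s1 ''balance'' 0 = (\<Sum>g = 1..m. if ?f g \<le> 1 then ?v g else - ?v g)"
    and ag: "agree (writes compute_balance) s s1"
  have fr: "nmem s1 ''goods'' 0 = m" "nmem s1 ''owner'' = ?f"
    using ag m by (simp_all add: agree_def compute_balance_def balance_step_def)
  have "(\<Sum>g = 1..m. if ?f g \<le> 1 then ?v g else - ?v g) =
      sum ?v {g\<in>{1..m}. ?f g = 1} - sum ?v {g\<in>{1..m}. ?f g = 2}"
  proof -
    have "(\<Sum>g = 1..m. if ?f g \<le> 1 then ?v g else - ?v g) =
        (\<Sum>g = 1..m. (if ?f g = 1 then ?v g else 0) - (if ?f g = 2 then ?v g else 0))"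
      by (rule sum.cong) (use own in auto)
    then show ?thesis
      by (simp add: sum_subtractf sum.If_cases Int_def)
  qed
  then have bal: "rmem s1 ''balance'' 0 = sum ?v {g\<in>{1..m}. ?f g = 1} - sum ?v {g\<in>{1..m}. ?f g = 2}"
    using bal by simp
  show "runs (Cond (RLe (RConst 0) (RLoad ''balance'' (NConst 0))) swap_bundles Skip) s1 (60 * m + 60)
    (\<lambda>s'. ((\<forall>g\<in>{1..m}. nmem s' ''owner'' g = ?f g) \<or> (\<forall>g\<in>{1..m}. nmem s' ''owner'' g = 3 - ?f g)) \<and>
    sum ?v {g\<in>{1..m}. nmem s' ''owner'' g = 1} \<le> sum ?v {g\<in>{1..m}. nmem s' ''owner'' g = 2})"
  proof (rule runs_Cond[where T = "60 * m + 40"], goal_cases)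
    case 1
    show ?case
    proof (rule runs_mono[OF runs_swap_bundles[OF fr(1)] order_refl])
      fix r :: state assume "\<forall>g\<in>{1..m}. nmem r ''owner'' g = 3 - nmem s1 ''owner'' g"
      then have r: "\<And>g. g \<in> {1..m} \<Longrightarrow> nmem r ''owner'' g = 3 - ?f g" using fr by simp
      have "nmem r ''owner'' g = 1 \<longleftrightarrow> ?f g = 2" "nmem r ''owner'' g = 2 \<longleftrightarrow> ?f g = 1" if "g \<in> {1..m}" for g
        using r[OF that] own[OF that] by auto
      then have "{g\<in>{1..m}. nmem r ''owner'' g = 1} = {g\<in>{1..m}. ?f g = 2}"
        "{g\<in>{1..m}. nmem r ''owner'' g = 2} = {g\<in>{1..m}. ?f g = 1}" by blast+
      then show "((\<forall>g\<in>{1..m}. nmem r ''owner'' g = ?f g) \<or> (\<forall>g\<in>{1..m}. nmem r ''owner'' g = 3 - ?f g)) \<and>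
        sum ?v {g\<in>{1..m}. nmem r ''owner'' g = 1} \<le> sum ?v {g\<in>{1..m}. nmem r ''owner'' g = 2}"
        using r 1 bal by simp
    qed
  next
    case 2
    then show ?case using bal fr by (intro runs_loop_free) auto
  qed simp
qed simp

subsection \<open>Envy-freeness of paired bundles\<close>

lemma sum_alternating_le:
  fixes v :: "nat \<Rightarrow> real" and f owner :: "nat \<Rightarrow> nat"
  assumes bij: "bij_betw f {..<2 * h} X" and h: "0 < h"
    and sorted: "\<And>k l. k < l \<Longrightarrow> l < 2 * h \<Longrightarrow> v (f l) \<le> v (f k)"
    and nonneg: "\<And>x. x \<in> X \<Longrightarrow> 0 \<le> v x"
    and own: "\<And>q. q < h \<Longrightarrow> {owner (f (2 * q)), owner (f (Suc (2 * q)))} = {i, j}"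
    and ij: "i \<noteq> j"
  shows "\<exists>x\<in>{x \<in> X. owner x = j}. sum v {x \<in> X. owner x = j} \<le> v x + sum v {x \<in> X. owner x = i}"
proof -
  \<comment> \<open>The position of the good that bundle \<open>k\<close> receives from pair
    \<open>q\<close>. It enumerates each bundle by the pairs, so the two sums can be compared pair
    by pair.\<close>
  define z where "z = (\<lambda>k q. if owner (f (2 * q)) = k then 2 * q else Suc (2 * q))"
  have zlt: "z k q < 2 * h" if "q < h" for k q
    using that by (simp add: z_def)
  have bij_bundle: "bij_betw (\<lambda>q. f (z k q)) {..<h} {x \<in> X. owner x = k}" if k: "k \<in> {i, j}" for k
    unfolding bij_betw_def
  proof
    show "inj_on (\<lambda>q. f (z k q)) {..<h}"
    proof (rule inj_onI)
      fix p q assume "p \<in> {..<h}" "q \<in> {..<h}" "f (z k p) = f (z k q)"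
      then have "z k p = z k q"
        using bij zlt by (auto simp: bij_betw_def dest: inj_onD)
      moreover have "z k r div 2 = r" for r by (simp add: z_def)
      ultimately show "p = q" by metis
    qed
    have owner_z: "owner (f (z k q)) = k" if "q < h" for q
      using own[OF that] ij k by (auto simp: z_def doubleton_eq_iff)
    show "(\<lambda>q. f (z k q)) ` {..<h} = {x \<in> X. owner x = k}"
    proof
      show "(\<lambda>q. f (z k q)) ` {..<h} \<subseteq> {x \<in> X. owner x = k}"
        using owner_z zlt bij by (auto simp: bij_betw_def)
      show "{x \<in> X. owner x = k} \<subseteq> (\<lambda>q. f (z k q)) ` {..<h}"
      proof
        fix x assume x: "x \<in> {x \<in> X. owner x = k}"
        then obtain l where l: "l < 2 * h" "x = f l" using bij by (auto simp: bij_betw_def)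
        define q where "q = l div 2"
        have q: "q < h" using l(1) by (simp add: q_def less_mult_imp_div_less mult.commute)
        have "l = 2 * q \<or> l = Suc (2 * q)" unfolding q_def by presburger
        then have "l = z k q"
          using x l(2) own[OF q] ij by (auto simp: z_def doubleton_eq_iff)
        then show "x \<in> (\<lambda>q. f (z k q)) ` {..<h}" using q l(2) by blast
      qed
    qed
  qed
  have sum_bundle: "sum v {x \<in> X. owner x = k} = (\<Sum>q<h. v (f (z k q)))" if "k \<in> {i, j}" for k
    using sum.reindex_bij_betw[OF bij_bundle[OF that], of v] by simp
  obtain h' where h': "h = Suc h'" using h by (cases h) auto
  have "(\<Sum>q<h. v (f (z j q))) = v (f (z j 0)) + (\<Sum>q<h'. v (f (z j (Suc q))))"
    unfolding h' by (rule sum.lessThan_Suc_shift)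
  \<comment> \<open>The shifted comparison: \<open>z j (Suc q)\<close> is at least
    \<open>2 * q + 2\<close>, while \<open>z i q\<close> is at most \<open>2 * q + 1\<close>, so
    sortedness applies whichever way the pairs are oriented.\<close>
  also have "(\<Sum>q<h'. v (f (z j (Suc q)))) \<le> (\<Sum>q<h'. v (f (z i q)))"
  proof (rule sum_mono)
    fix q assume "q \<in> {..<h'}"
    then show "v (f (z j (Suc q))) \<le> v (f (z i q))"
      by (intro sorted zlt) (auto simp: h' z_def)
  qed
  \<comment> \<open>The good of \<open>i\<close> from the last pair has no partner in the shift and
    is nonnegative.\<close>
  also have "\<dots> \<le> (\<Sum>q<h. v (f (z i q)))"
    using nonneg zlt[of h' i] bij by (auto simp: h' bij_betw_def)
  finally have "sum v {x \<in> X. owner x = j} \<le> v (f (z j 0)) + sum v {x \<in> X. owner x = i}"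
    using sum_bundle by simp
  moreover have "f (z j 0) \<in> {x \<in> X. owner x = j}"
    using bij_bundle[of j] h by (auto simp: bij_betw_def)
  ultimately show ?thesis by blast
qed

text \<open>Transfers \<open>sum_alternating_le\<close> from the padded goods \<open>X\<close> to
  the real goods \<open>M\<close>. Padding goods are worthless, so the bundle values agree; only the
  good to be removed may have to be replaced by a real one.\<close>

lemma EF1_of_paired_bundles:
  fixes v :: "nat \<Rightarrow> real" and f owner :: "nat \<Rightarrow> nat"
  assumes bij: "bij_betw f {..<2 * h} X" and h: "0 < h" and fin: "finite X" and MX: "M \<subseteq> X"
    and sorted: "\<And>k l. k < l \<Longrightarrow> l < 2 * h \<Longrightarrow> v (f l) \<le> v (f k)"
    and nonneg: "\<And>x. x \<in> M \<Longrightarrow> 0 \<le> v x" and zero: "\<And>x. x \<in> X - M \<Longrightarrow> v x = 0"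
    and own: "\<And>q. q < h \<Longrightarrow> {owner (f (2 * q)), owner (f (Suc (2 * q)))} = {i, j}"
    and ij: "i \<noteq> j"
    and ne: "{x \<in> M. owner x = j} \<noteq> {}"
  shows "\<exists>x\<in>{x \<in> M. owner x = j}. sum v ({x \<in> M. owner x = j} - {x}) \<le> sum v {x \<in> M. owner x = i}"
proof -
  have pad: "sum v {x \<in> X. owner x = k} = sum v {x \<in> M. owner x = k}" for k
    by (rule sum.mono_neutral_right) (use fin MX zero in auto)
  have finM: "finite M" using fin MX finite_subset by blast
  have nonneg_X: "\<And>x. x \<in> X \<Longrightarrow> 0 \<le> v x" using nonneg zero by (metis Diff_iff order_refl)
  obtain x where x: "x \<in> X" "owner x = j"
    "sum v {x \<in> M. owner x = j} \<le> v x + sum v {x \<in> M. owner x = i}"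
    using sum_alternating_le[where f = f and v = v and owner = owner, OF bij h sorted nonneg_X own ij]
    unfolding pad by blast
  show ?thesis
  proof (cases "x \<in> M")
    case True
    then show ?thesis using x finM by (intro bexI[of _ x]) (auto simp: sum_diff1)
  next
    case False
    \<comment> \<open>If the good to be removed is padding, there is no envy even before removal,
      and any real good of the bundle will do.\<close>
    then have "v x = 0" using zero x(1) by simp
    moreover obtain y where "y \<in> M" "owner y = j" using ne by blast
    ultimately show ?thesis
      using x(3) finM nonneg[of y] by (intro bexI[of _ y]) (auto simp: sum_diff1)
  qed
qed

section \<open>Correctness and running time of the whole program\<close>

definition allocate :: com where
  "allocate =
    Seq pad (Seq init_order (Seq merge_sort (Seq rank_goods
      (Seq fill_buckets (Seq orient_pairs choose_bundle)))))"

lemma doubleton_reflect: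
  fixes a b :: nat
  shows "{a, b} = {1, 2} \<Longrightarrow> {3 - a, 3 - b} = {1, 2}"
  by (auto simp: doubleton_eq_iff)

lemma exec_allocate:
  assumes inst: "fair_division_instance m E v" and list: "edge_listing E es"
    and d: "m \<le> 2 ^ Suc d" "d = 0 \<or> 2 ^ d < m"
  shows "\<exists>t s. exec allocate (input_state m es v) t s \<and>
    complete_allocation {1..m} (output_allocation m s) \<and>
    EF1 v (output_allocation m s) \<and>
    2 * violations E (output_allocation m s) \<le> card E \<and>
    t \<le> 5000 * (2 ^ d * (d + 1)) + 200 * card E"
proof -
  let ?N = "2 * 2 ^ d :: nat"
  define c where "c = length es"
  define s0 where "s0 = input_state m es v"
  define x where "x = (\<lambda>e. if e < c then fst (es ! e) else 0)"
  define y where "y = (\<lambda>e. if e < c then snd (es ! e) else 0)"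
  \<comment> \<open>\<open>v1\<close> and \<open>v2\<close> extend the valuations of single goods by
    0 to the padding goods, exactly as the input memory does.\<close>
  define v1 where "v1 = (\<lambda>g. if g \<in> {1..m} then v 1 {g} else 0)"
  define v2 where "v2 = (\<lambda>g. if g \<in> {1..m} then v 2 {g} else 0)"
  have s0: "nmem s0 ''goods'' 0 = m" "nmem s0 ''edges'' 0 = c" "nmem s0 ''tail'' = x" "nmem s0 ''head'' = y"
    "nmem s0 ''first'' = (\<lambda>_. 0)" "rmem s0 ''value1'' = v1" "rmem s0 ''value2'' = v2" "rmem s0 ''balance'' 0 = 0"
    by (simp_all add: s0_def input_state_def c_def x_def y_def v1_def v2_def)

  \<comment> \<open>Distinctness of the listing makes edge indices count edges.\<close>
  have E: "E = (\<lambda>e. {x e, y e}) ` {..<c}" and card_E: "card E = c"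
  proof -
    have "E = set (map (\<lambda>(u, w). {u, w}) es)" "distinct (map (\<lambda>(u, w). {u, w}) es)"
      using list by (auto simp: edge_listing_def)
    then show "card E = c" by (metis c_def distinct_card length_map)
    have "map (\<lambda>(u, w). {u, w}) es = map (\<lambda>e. {x e, y e}) [0..<c]"
      by (rule nth_equalityI) (auto simp: c_def x_def y_def split: prod.split)
    with \<open>E = _\<close> show "E = (\<lambda>e. {x e, y e}) ` {..<c}" by (simp add: atLeast0LessThan)
  qed
  have ends: "x e \<noteq> y e" "x e \<in> {1..m}" "y e \<in> {1..m}" if "e < c" for e
  proof -
    have "{x e, y e} \<in> E" using that E by blast
    then have "{x e, y e} \<subseteq> {1..m} \<and> card {x e, y e} = 2"
      using inst unfolding fair_division_instance_def simple_graph_def by blast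
    then show "x e \<noteq> y e" "x e \<in> {1..m}" "y e \<in> {1..m}" by auto
  qed
  have val: "v i S = (\<Sum>g\<in>S. v i {g})" "0 \<le> v i S" if "S \<subseteq> {1..m}" "i \<in> {1, 2}" for i S
    using inst that unfolding fair_division_instance_def additive_valuation_def by blast+
  have sum_v1: "v 1 S = sum v1 S" and sum_v2: "v 2 S = sum v2 S" if "S \<subseteq> {1..m}" for S
    using val(1)[OF that, of 1] val(1)[OF that, of 2] that
    by (auto simp: v1_def v2_def intro!: sum.cong)

  obtain t1 s1 where e1: "exec pad s0 t1 s1" and t1: "t1 \<le> 40 * (d + 1)"
    and n1: "nmem s1 ''n'' 0 = ?N" and ag1: "agree (writes pad) s0 s1"
    using runs_pad[OF s0(1) d] by (auto elim: runsE)
  have s1: "nmem s1 ''goods'' 0 = m" "nmem s1 ''edges'' 0 = c" "nmem s1 ''tail'' = x" "nmem s1 ''head'' = y"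
    "nmem s1 ''first'' = (\<lambda>_. 0)" "rmem s1 ''value1'' = v1" "rmem s1 ''value2'' = v2" "rmem s1 ''balance'' 0 = 0"
    using ag1 s0 by (simp_all add: agree_def pad_def)

  obtain t2 s2 where e2: "exec init_order s1 t2 s2" and t2: "t2 \<le> 40 * ?N + 40"
    and o2: "\<forall>k<?N. nmem s2 ''order'' k = Suc k" and ag2: "agree (writes init_order) s1 s2"
    using runs_init_order[OF n1] by (auto elim: runsE)
  have s2: "nmem s2 ''goods'' 0 = m" "nmem s2 ''edges'' 0 = c" "nmem s2 ''tail'' = x" "nmem s2 ''head'' = y"
    "nmem s2 ''first'' = (\<lambda>_. 0)" "rmem s2 ''value1'' = v1" "rmem s2 ''value2'' = v2" "rmem s2 ''balance'' 0 = 0"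
    "nmem s2 ''n'' 0 = 2 ^ Suc d"
    using ag2 s1 n1 by (simp_all add: agree_def init_order_def order_step_def)

  obtain t3 s3 where e3: "exec merge_sort s2 t3 s3" and t3: "t3 \<le> 700 * ?N * (d + 2)"
    and sorted: "sorted_desc v1 (map (nmem s3 ''order'') [0..<?N])"
    and mset: "mset (map (nmem s3 ''order'') [0..<?N]) = mset (map (nmem s2 ''order'') [0..<?N])"
    and ag3: "agree (writes merge_sort) s2 s3"
    using runs_merge_sort[OF s2(9)] s2(6) by (auto elim: runsE)
  have s3: "nmem s3 ''goods'' 0 = m" "nmem s3 ''edges'' 0 = c" "nmem s3 ''tail'' = x" "nmem s3 ''head'' = y"
    "nmem s3 ''first'' = (\<lambda>_. 0)" "rmem s3 ''value2'' = v2" "rmem s3 ''balance'' 0 = 0"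
    "nmem s3 ''n'' 0 = ?N"
    using ag3 s2 by (simp_all add: agree_def merge_sort_def writes_merge_pass writes_merge_blocks)
  define f where "f = nmem s3 ''order''"
  \<comment> \<open>Sorting preserves the multiset of the initial order, which lists every padded
    good once.\<close>
  have bij: "bij_betw f {..<?N} {1..?N}"
  proof -
    have "map (nmem s2 ''order'') [0..<?N] = [1..<Suc ?N]"
      using o2 by (intro nth_equalityI) (auto simp del: upt_Suc)
    then have m: "mset (map f [0..<?N]) = mset [1..<Suc ?N]"
      using mset by (simp add: f_def)
    have "distinct (map f [0..<?N])"
      using mset_eq_imp_distinct_iff[OF m] by simp
    moreover have "set (map f [0..<?N]) = {1..?N}"
      using mset_eq_setD[OF m] by auto
    ultimately show ?thesis
      by (simp add: bij_betw_def distinct_map atLeast0LessThan)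
  qed
  then have inj: "inj_on (nmem s3 ''order'') {..<?N}" by (simp add: bij_betw_def f_def)
  have desc: "v1 (f l) \<le> v1 (f k)" if "k < l" "l < ?N" for k l
    using sorted that by (simp add: sorted_wrt_iff_nth_less f_def)

  obtain t4 s4 where e4: "exec rank_goods s3 t4 s4" and t4: "t4 \<le> 80 * 2 ^ d + 40"
    and r4: "\<forall>k<?N. nmem s4 ''rank'' (f k) = k div 2"
    and ag4: "agree (writes rank_goods) s3 s4"
    using runs_rank_goods[OF s3(8) inj] by (auto elim: runsE simp: f_def)
  have s4: "nmem s4 ''goods'' 0 = m" "nmem s4 ''edges'' 0 = c" "nmem s4 ''tail'' = x" "nmem s4 ''head'' = y"
    "nmem s4 ''first'' = (\<lambda>_. 0)" "rmem s4 ''value2'' = v2" "rmem s4 ''balance'' 0 = 0"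
    "nmem s4 ''n'' 0 = ?N" "nmem s4 ''order'' = f"
    using ag4 s3 by (simp_all add: agree_def rank_goods_def rank_step_def f_def)

  obtain t5 s5 where e5: "exec fill_buckets s4 t5 s5" and t5: "t5 \<le> 100 * c + 40"
    and c5: "\<And>q. chain (nmem s5 ''next'') (nmem s5 ''first'' q) (bucket s4 c q)"
    and ag5: "agree (writes fill_buckets) s4 s5"
    using runs_fill_buckets[OF s4(2,5)] by (auto elim: runsE)
  have s5: "nmem s5 ''goods'' 0 = m" "nmem s5 ''tail'' = x" "nmem s5 ''head'' = y"
    "rmem s5 ''value2'' = v2" "rmem s5 ''balance'' 0 = 0"
    "nmem s5 ''n'' 0 = ?N" "nmem s5 ''order'' = f" "nmem s5 ''rank'' = nmem s4 ''rank''"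
    using ag5 s4 by (simp_all add: agree_def fill_buckets_def bucket_step_def)
  \<comment> \<open>Buckets depend only on \<open>rank\<close>, \<open>tail\<close> and
    \<open>head\<close>, which filling them does not change.\<close>
  have "bucket s4 c q = bucket s5 c q" for q
    using s4 s5 by (simp add: bucket_def bucket_of_def)
  with c5 have c5: "\<And>q. chain (nmem s5 ''next'') (nmem s5 ''first'' q) (bucket s5 c q)" by simp

  have "{1..m} \<subseteq> f ` {..<?N}"
    using bij d(1) by (auto simp: bij_betw_def)
  then have "nmem s5 ''tail'' e \<noteq> nmem s5 ''head'' e \<and>
      nmem s5 ''tail'' e \<in> nmem s5 ''order'' ` {..<?N} \<and> nmem s5 ''head'' e \<in> nmem s5 ''order'' ` {..<?N}"
    if "e < c" for e
    using ends[OF that] s5 by auto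
  moreover have "inj_on (nmem s5 ''order'') {..<?N}"
    "\<And>k. k < ?N \<Longrightarrow> nmem s5 ''rank'' (nmem s5 ''order'' k) = k div 2"
    using inj r4 s5 by (simp_all add: f_def)
  ultimately have "runs orient_pairs s5 (300 * 2 ^ d + 100 * c + 50)
    (\<lambda>s'. (\<forall>q<2 ^ d. {nmem s' ''owner'' (nmem s5 ''order'' (2 * q)), nmem s' ''owner'' (nmem s5 ''order'' (Suc (2 * q)))} = {1, 2}) \<and>
      2 * card {e. e < c \<and> monochromatic s5 (nmem s' ''owner'') e} \<le> c)"
    using runs_orient_pairs[OF s5(6) _ _ c5] by blast
  then obtain t6 s6 where e6: "exec orient_pairs s5 t6 s6" and t6: "t6 \<le> 300 * 2 ^ d + 100 * c + 50"
    and pairs: "\<And>q. q < 2 ^ d \<Longrightarrow> {nmem s6 ''owner'' (f (2 * q)), nmem s6 ''owner'' (f (Suc (2 * q)))} = {1, 2}"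
    and few: "2 * card {e. e < c \<and> nmem s6 ''owner'' (x e) = nmem s6 ''owner'' (y e)} \<le> c"
    and ag6: "agree (writes orient_pairs) s5 s6"
    using s5 by (auto elim: runsE simp: monochromatic_def)
  define own where "own = nmem s6 ''owner''"
  have s6: "nmem s6 ''goods'' 0 = m" "rmem s6 ''value2'' = v2" "rmem s6 ''balance'' 0 = 0"
    using ag6 s5 by (simp_all add: agree_def orient_pairs_def writes_orient_step)
  have own: "own g \<in> {1, 2}" if g: "g \<in> {1..?N}" for g
  proof -
    obtain k where k: "k < ?N" "g = f k"
      using bij g unfolding bij_betw_def by blast
    have "k div 2 < 2 ^ d" using k(1) by linarith
    moreover have "k = 2 * (k div 2) \<or> k = Suc (2 * (k div 2))" by presburger
    ultimately show ?thesis using pairs[of "k div 2"] k(2) by (metis own_def insertI1 insertI2)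
  qed
  have sub: "{1..m} \<subseteq> {1..?N}" using d(1) by auto

  have "\<And>g. g \<in> {1..m} \<Longrightarrow> nmem s6 ''owner'' g \<in> {1, 2}"
    using own sub by (auto simp: own_def)
  from runs_choose_bundle[OF s6(1,3) this] obtain t7 s7 where
    e7: "exec choose_bundle s6 t7 s7" and t7: "t7 \<le> 120 * m + 100"
    and flip: "(\<forall>g\<in>{1..m}. nmem s7 ''owner'' g = own g) \<or> (\<forall>g\<in>{1..m}. nmem s7 ''owner'' g = 3 - own g)"
    and better: "sum v2 {g\<in>{1..m}. nmem s7 ''owner'' g = 1} \<le> sum v2 {g\<in>{1..m}. nmem s7 ''owner'' g = 2}"
    unfolding s6(2) by (auto elim!: runsE simp: own_def)
  \<comment> \<open>The swap touches only the goods up to \<open>m\<close>, so the final memory need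
    not split the padded pairs. The map \<open>w\<close> reflects all goods or none, and hence still
    splits every pair, as \<open>EF1_of_paired_bundles\<close> requires.\<close>
  obtain w where w: "w = own \<or> w = (\<lambda>g. 3 - own g)" "\<And>g. g \<in> {1..m} \<Longrightarrow> nmem s7 ''owner'' g = w g"
    using flip that[of own] that[of "\<lambda>g. 3 - own g"] by fast
  let ?A = "output_allocation m s7"
  have A: "?A i = {g \<in> {1..m}. w g = i}" for i
    using w(2) by (auto simp: output_allocation_def)
  have own_m: "own g = 1 \<or> own g = 2" if "g \<in> {1..m}" for g
    using own[of g] that sub by auto
  have w_pairs: "{w (f (2 * q)), w (f (Suc (2 * q)))} = {1, 2}" if "q < 2 ^ d" for q
    using w(1) pairs[OF that] doubleton_reflect unfolding own_def by auto

  have complete: "complete_allocation {1..m} ?A"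
    unfolding complete_allocation_def A using own_m w(1) by fastforce

  have "EF1 v ?A"
  proof -
    have "\<exists>g\<in>?A 2. v 1 (?A 1) \<ge> v 1 (?A 2 - {g})" if "?A 2 \<noteq> {}"
    proof -
      have "\<exists>g\<in>{g \<in> {1..m}. w g = 2}. sum v1 ({g \<in> {1..m}. w g = 2} - {g}) \<le> sum v1 {g \<in> {1..m}. w g = 1}"
      proof (rule EF1_of_paired_bundles[where f = f and v = v1 and owner = w, OF bij _ _ sub desc])
        show "0 \<le> v1 g" if "g \<in> {1..m}" for g
          using val(2)[of "{g}" 1] that by (simp add: v1_def)
        show "v1 g = 0" if "g \<in> {1..?N} - {1..m}" for g
          using that by (auto simp: v1_def)
        show "{g \<in> {1..m}. w g = 2} \<noteq> {}" using that by (simp add: A)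
      qed (use w_pairs in auto)
      then obtain g where g: "g \<in> ?A 2" "sum v1 (?A 2 - {g}) \<le> sum v1 (?A 1)"
        unfolding A by blast
      moreover have "?A 1 \<subseteq> {1..m}" "?A 2 - {g} \<subseteq> {1..m}"
        by (auto simp: A)
      ultimately have "v 1 (?A 1) \<ge> v 1 (?A 2 - {g})"
        using sum_v1[of "?A 1"] sum_v1[of "?A 2 - {g}"] by simp
      then show ?thesis using g(1) by blast
    qed
    \<comment> \<open>Agent 2 does not envy the full bundle 1, so by nonnegativity any good may be
      removed.\<close>
    moreover have "v 2 (?A 2) \<ge> v 2 (?A 1 - {g})" for g
    proof -
      have "v 2 (?A 1 - {g}) = sum v2 (?A 1 - {g})" by (rule sum_v2) (auto simp: A)
      also have "\<dots> \<le> sum v2 (?A 1)"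
        using val(2)[of "{_}" 2] by (intro sum_mono2) (auto simp: A v2_def)
      also have "\<dots> \<le> sum v2 (?A 2)" using better by (simp add: output_allocation_def)
      also have "\<dots> = v 2 (?A 2)" by (rule sum_v2[symmetric]) (auto simp: A)
      finally show ?thesis .
    qed
    ultimately show ?thesis by (auto simp: EF1_def)
  qed

  moreover have "2 * violations E ?A \<le> card E"
  proof -
    \<comment> \<open>Reflection is injective on the owners 1 and 2, so an edge inside a final
      bundle was already monochromatic before the choice of agent 2.\<close>
    have "{e \<in> E. \<exists>i\<in>{1, 2}. e \<subseteq> ?A i} \<subseteq> (\<lambda>e. {x e, y e}) ` {e. e < c \<and> own (x e) = own (y e)}"
    proof
      fix b assume "b \<in> {e \<in> E. \<exists>i\<in>{1, 2}. e \<subseteq> ?A i}"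
      then obtain e i where e: "e < c" "b = {x e, y e}" "b \<subseteq> ?A i"
        using E by blast
      then have "w (x e) = w (y e)" by (simp add: A)
      then have "own (x e) = own (y e)"
        using w(1) own_m[OF ends(2)[OF e(1)]] own_m[OF ends(3)[OF e(1)]] by auto
      then show "b \<in> (\<lambda>e. {x e, y e}) ` {e. e < c \<and> own (x e) = own (y e)}"
        using e by blast
    qed
    then have "violations E ?A \<le> card {e. e < c \<and> own (x e) = own (y e)}"
      unfolding violations_def by (rule surj_card_le[rotated]) simp
    then show ?thesis using few card_E by (simp add: own_def)
  qed

  moreover have "exec allocate s0 (t1 + (t2 + (t3 + (t4 + (t5 + (t6 + t7)))))) s7"
    unfolding allocate_def
    by (rule exec.Seq[OF e1 exec.Seq[OF e2 exec.Seq[OF e3 exec.Seq[OF e4 exec.Seq[OF e5 exec.Seq[OF e6 e7]]]]]])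

  moreover have "t1 + (t2 + (t3 + (t4 + (t5 + (t6 + t7))))) \<le> 5000 * (2 ^ d * (d + 1)) + 200 * card E"
  proof -
    \<comment> \<open>Naming the products \<open>2 ^ d\<close> and \<open>2 ^ d * d\<close> makes
      the summation of all running times a linear problem.\<close>
    define H :: nat where "H = 2 ^ d"
    define K where "K = H * d"
    have "1 \<le> H" "d \<le> K" "m \<le> 2 * H"
      using d(1) by (simp_all add: H_def K_def)
    moreover have "t3 \<le> 1400 * K + 2800 * H" using t3 by (simp add: H_def K_def algebra_simps)
    ultimately have "t1 + (t2 + (t3 + (t4 + (t5 + (t6 + t7))))) \<le> 5000 * (K + H) + 200 * c"
      using t1 t2 t4 t5 t6 t7 unfolding H_def[symmetric] distrib_left by linarith
    then show ?thesis by (simp add: card_E H_def K_def algebra_simps)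
  qed

  ultimately show ?thesis using complete unfolding s0_def by blast
qed

section \<open>The running time in terms of the numbers of goods and edges\<close>

theorem theorem8:
  "\<exists>(P :: com) (C :: real). \<forall>(m :: nat) (E :: nat set set) (v :: nat \<Rightarrow> nat set \<Rightarrow> real) (es :: (nat \<times> nat) list).
     fair_division_instance m E v \<longrightarrow> edge_listing E es \<longrightarrow>
     (\<exists>t s. exec P (input_state m es v) t s \<and>
        complete_allocation {1..m} (output_allocation m s) \<and>
        EF1 v (output_allocation m s) \<and>
        real (violations E (output_allocation m s)) \<le> real (card E) / 2 \<and>
        (if 2 \<le> m then real t \<le> C * (real m * log 2 (real m) + real (card E))
         else real t \<le> C))"
proof (rule exI[of _ allocate], rule exI[of _ 10000], intro allI impI)
  fix m E v es
  assume inst: "fair_division_instance m E v" and list: "edge_listing E es"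
  \<comment> \<open>By minimality \<open>2 ^ d < m\<close> unless \<open>d = 0\<close>; apart from
    that case, padding to \<open>2 ^ Suc d\<close> less than doubles the number of goods.\<close>
  define d where "d = (LEAST d. m \<le> 2 ^ Suc d)"
  have "m \<le> 2 ^ Suc m" by (meson less_exp less_imp_le_nat Suc_le_lessD Suc_leI le_trans lessI)
  then have d1: "m \<le> 2 ^ Suc d" unfolding d_def by (rule LeastI)
  have d2: "d = 0 \<or> 2 ^ d < m"
  proof (cases d)
    case (Suc k)
    then have "\<not> m \<le> 2 ^ Suc k"
      using not_less_Least[of k "\<lambda>d. m \<le> 2 ^ Suc d"] by (simp add: d_def)
    then show ?thesis using Suc by simp
  qed simp
  obtain t s where *: "exec allocate (input_state m es v) t s"
    "complete_allocation {1..m} (output_allocation m s)" "EF1 v (output_allocation m s)"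
    "2 * violations E (output_allocation m s) \<le> card E"
    "t \<le> 5000 * (2 ^ d * (d + 1)) + 200 * card E"
    using exec_allocate[OF inst list d1 d2] by blast
  have t: "real t \<le> 5000 * (2 ^ d * (real d + 1)) + 200 * real (card E)"
  proof -
    have "real t \<le> real (5000 * (2 ^ d * (d + 1)) + 200 * card E)"
      using *(5) by (simp only: of_nat_le_iff)
    then show ?thesis by (simp add: algebra_simps)
  qed
  have "if 2 \<le> m then real t \<le> 10000 * (real m * log 2 (real m) + real (card E)) else real t \<le> 10000"
  proof (cases "2 \<le> m")
    case True
    then have log: "1 \<le> log 2 (real m)" by simp
    \<comment> \<open>From \<open>2 ^ d < m\<close> follows \<open>d \<le> log 2 m\<close>, and
      \<open>m \<ge> 2\<close> makes the logarithm at least 1, so \<open>d + 1\<close> is at most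
      twice the logarithm. This factor 2 turns the constant 5000 into 10000.\<close>
    have "2 ^ d * (real d + 1) \<le> real m * (2 * log 2 (real m))"
    proof (cases "d = 0")
      case False
      then have "2 ^ d < m" using d2 by simp
      then have "2 ^ d < real m" using of_nat_less_iff[of "2 ^ d" m, where 'a = real] by simp
      moreover from this have "real d \<le> log 2 (real m)" by (simp add: le_log_iff powr_realpow)
      then have "real d + 1 \<le> 2 * log 2 (real m)" using log by linarith
      ultimately show ?thesis by (intro mult_mono) auto
    next
      case 0: True
      have "1 \<le> 2 * log 2 (real m)" using log by linarith
      then have "1 * 1 \<le> real m * (2 * log 2 (real m))"
        using True by (intro mult_mono) auto
      then show ?thesis using 0 by simp
    qed
    then show ?thesis using t True by simp
  next
    case False
    \<comment> \<open>With at most one good there is no edge and \<open>d = 0\<close>, so the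
      running time is at most 5000.\<close>
    have "E = {}"
    proof (rule ccontr)
      assume "E \<noteq> {}"
      then obtain e where "e \<subseteq> {1..m}" "card e = 2"
        using inst by (auto simp: fair_division_instance_def simple_graph_def)
      then show False using card_mono[of "{1..m}" e] False by simp
    qed
    moreover have "d = 0" using d2 False one_le_power[of "2 :: nat" d] by linarith
    ultimately show ?thesis using t False by simp
  qed
  moreover have "real (violations E (output_allocation m s)) \<le> real (card E) / 2"
    using *(4) by linarith
  ultimately show "\<exists>t s. exec allocate (input_state m es v) t s \<and>
      complete_allocation {1..m} (output_allocation m s) \<and>
      EF1 v (output_allocation m s) \<and>
      real (violations E (output_allocation m s)) \<le> real (card E) / 2 \<and>
      (if 2 \<le> m then real t \<le> 10000 * (real m * log 2 (real m) + real (card E)) else real t \<le> 10000)"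
    using *(1-3) by blast
qed

end
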